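(* Let $d\ge 2$ and let $D$ be a (nonempty) $d$-ary tree. If $I_d(D)=\eta_d(D)$, then $$\max_{\substack{\|T\|=(d-1)n+1\\ T\text{ strictly }d\text{-ary tree}}}\gamma(D,T)=I_d(D)+\mathcal{O}(n^{-1})$$ as $n\to\infty$.
   Context: A $d$-ary tree is a finite rooted tree in which every internal (non-leaf) vertex has at least two and at most $d$ children; a single vertex is a $d$-ary tree with one leaf. A strictly $d$-ary tree is a rooted tree in which every internal vertex has exactly $d$ children (its number of leaves is always congruent to $1$ modulo $d-1$). Isomorphism means root-preserving isomorphism. $\|T\|$ denotes the number of leaves of $T$. A set $S$ of leaves of $T$ induces a $d$-ary tree: take the smallest subtree of $T$ containing all leaves in $S$ (rooted at the most recent common ancestor of $S$) and repeatedly suppress every vertex with exactly one child (contracting its two adjacent edges to a single edge). $c(D,T)$ is the number of sets of $\|D\|$ leaves of $T$ that induce a tree isomorphic to $D$, and $\gamma(D,T)=c(D,T)/\binom{\|T\|}{\|D\|}$. The $d$-ary inducibility of a $d$-ary tree $D$ is $$I_d(D)=\limsup_{n\to\infty}\ \max_{\substack{\|T\|=n\\ T\ d\text{-ary tree}}}\gamma(D,T).$$ The strictly $d$-ary trees $H_n^d$ ($n\ge 0$) are defined recursively: $H_0^d$ is a single leaf; for $n>0$ write $n-1=ds+b$ with $b\in\{0,1,\ldots,d-1\}$, take $d-b$ copies of $H_s^d$ and $b$ copies of $H_{s+1}^d$, and connect a new common root to each of their roots by an edge to obtain $H_n^d$, which has $(d-1)n+1$ leaves. For a $d$-ary tree $D$,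 $\eta_d(D)=\lim_{n\to\infty}\gamma(D,H_n^d)$ (this limit exists). *)

theory Defs
  imports Complex_Main "HOL-Library.Extended_Real" "HOL-Library.Landau_Symbols"
begin

(* Finite rooted trees are represented with an arbitrary ordering of the children of each
   vertex; tree_iso below forgets this ordering. *)
datatype tree = Node (children: "tree list")

lemma size_nth_less [termination_simp]:
  "i < length ts \<Longrightarrow> size (ts ! i) < Suc (size_list size ts)"
  by (metis nth_mem size_list_estimation' le_imp_less_Suc order_refl)

(* A vertex is addressed by the list of child positions on the path from the root to it,
   so [] is the root and the children of p are the vertices p @ [i]. *)
fun verts :: "tree \<Rightarrow> nat list set" where
  "verts (Node ts) = insert [] (\<Union>i\<in>{..<length ts}. (#) i ` verts (ts ! i))"

definition is_child :: "nat list \<Rightarrow> nat list \<Rightarrow> bool" where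
  "is_child p q \<longleftrightarrow> (\<exists>i. q = p @ [i])"

definition leaves :: "tree \<Rightarrow> nat list set" where
  "leaves T = {p \<in> verts T. \<not> (\<exists>q \<in> verts T. is_child p q)}"

definition num_leaves :: "tree \<Rightarrow> nat" where
  "num_leaves T = card (leaves T)"

definition tree_iso :: "tree \<Rightarrow> tree \<Rightarrow> bool" where
  "tree_iso T U \<longleftrightarrow>
     (\<exists>f. bij_betw f (verts T) (verts U) \<and> f [] = [] \<and>
          (\<forall>p \<in> verts T. \<forall>q \<in> verts T. is_child p q \<longleftrightarrow> is_child (f p) (f q)))"

fun dary :: "nat \<Rightarrow> tree \<Rightarrow> bool" where
  "dary d (Node ts) \<longleftrightarrow>
     (ts = [] \<or> 2 \<le> length ts \<and> length ts \<le> d) \<and> (\<forall>t \<in> set ts. dary d t)"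

fun strictly_dary :: "nat \<Rightarrow> tree \<Rightarrow> bool" where
  "strictly_dary d (Node ts) \<longleftrightarrow>
     (ts = [] \<or> length ts = d) \<and> (\<forall>t \<in> set ts. strictly_dary d t)"

(* For a nonempty set S of leaves of T: the subtree of T formed by the root of T and all
   paths from it to the elements of S. *)
fun span_tree :: "nat list set \<Rightarrow> tree \<Rightarrow> tree" where
  "span_tree S (Node ts) =
     Node (map (\<lambda>i. span_tree {p. i # p \<in> S} (ts ! i))
               (filter (\<lambda>i. \<exists>p. i # p \<in> S) [0..<length ts]))"

(* Suppresses every vertex with exactly one child. A root with exactly one child is
   deleted, so in span_tree S T the root moves down to the most recent common ancestor
   of S. *)
fun suppress :: "tree \<Rightarrow> tree" where
  "suppress (Node []) = Node []"
| "suppress (Node [t]) = suppress t"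
| "suppress (Node (t # u # ts)) = Node (map suppress (t # u # ts))"

definition induced_tree :: "nat list set \<Rightarrow> tree \<Rightarrow> tree" where
  "induced_tree S T = suppress (span_tree S T)"

definition copies :: "tree \<Rightarrow> tree \<Rightarrow> nat" where
  "copies D T =
     card {S. S \<subseteq> leaves T \<and> card S = num_leaves D \<and> tree_iso (induced_tree S T) D}"

definition copy_density :: "tree \<Rightarrow> tree \<Rightarrow> real" where
  "copy_density D T = real (copies D T) / real (num_leaves T choose num_leaves D)"

(* For n = 0 the maximum is taken over the empty set, hence unspecified; this does not
   affect the limit superior. *)
definition inducibility :: "nat \<Rightarrow> tree \<Rightarrow> real" where
  "inducibility d D =
     real_of_ereal (limsup (\<lambda>n. ereal (Max {copy_density D T | T. dary d T \<and> num_leaves T = n})))"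

(* The test b = 0 only serves termination: for n = 1 the second kind of copy would be
   the tree being defined. *)
function H_tree :: "nat \<Rightarrow> nat \<Rightarrow> tree" where
  "H_tree d n =
     (if n = 0 then Node []
      else let s = (n - 1) div d; b = (n - 1) mod d
           in Node (replicate (d - b) (H_tree d s) @
                    (if b = 0 then [] else replicate b (H_tree d (s + 1)))))"
  by pat_completeness auto
termination
proof (relation "measure snd", goal_cases)
  case (2 d n s b)
  have "(n - 1) div d \<le> n - 1" by (rule div_le_dividend)
  also have "n - 1 < n" using 2 by simp
  finally show ?case using 2 by simp
next
  case (3 d n s b)
  show ?case
  proof (cases "d = 0")
    case True
    with 3 show ?thesis by (cases n) auto
  next
    case False
    from 3 have b: "(n - 1) mod d > 0" by simp
    then have "n - 1 \<noteq> 0" "d \<noteq> 1" by (intro notI; simp)+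
    with False have "(n - 1) div d < n - 1" by (intro div_less_dividend) auto
    then show ?thesis using 3 by simp
  qed
qed auto

declare H_tree.simps [simp del]

definition eta :: "nat \<Rightarrow> tree \<Rightarrow> real" where
  "eta d D = lim (\<lambda>n. copy_density D (H_tree d n))"

end

theory Submission
  imports Defs "HOL-Library.Multiset" "HOL-Library.FuncSet" "HOL-Combinatorics.Permutations"
begin

text \<open>Upper bound, for every \<open>d\<close>-ary tree \<open>T\<close> with \<open>n\<close> leaves: replacing each leaf of \<open>T\<close> by a tree
  with \<open>m\<close> leaves turns every copy of \<open>D\<close> into at least \<open>m ^ k\<close> copies, where \<open>k\<close> is the number of
  leaves of \<open>D\<close>. Letting \<open>m\<close> grow gives \<open>I \<ge> c(D, T) k! / n ^ k\<close>, hence \<open>\<gamma>(D, T) \<le> I + k\<^sup>2 / n\<close>.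

  Lower bound: a copy of \<open>D\<close> in a tree either lies in one branch or distributes the branches of \<open>D\<close>
  over distinct branches of the tree. For the balanced trees \<open>H\<close> with \<open>N\<close> leaves this is a recursion
  for \<open>c(D, H) / N ^ k\<close>, and by induction on \<open>D\<close> that quantity is \<open>a + O(1 / N)\<close>. So \<open>\<gamma>(D, H)\<close>
  converges to \<open>\<eta>\<close> at rate \<open>1 / N\<close>, and the hypothesis identifies \<open>\<eta>\<close> with \<open>I\<close>.\<close>

subsection \<open>Isomorphism classes as nested multisets\<close>

text \<open>With children collected in multisets, isomorphic trees become equal values, so an
  isomorphism class can be an argument of functions and the subject of an induction.\<close>

datatype mtree = MNode "mtree multiset"

primrec canon :: "tree \<Rightarrow> mtree" where
  "canon (Node ts) = MNode (mset (map canon ts))"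

lemma Nil_in_verts [simp]: "[] \<in> verts T"
  by (cases T) auto

lemma Cons_in_verts_iff [simp]: "i # p \<in> verts (Node ts) \<longleftrightarrow> i < length ts \<and> p \<in> verts (ts ! i)"
  by auto

lemma is_child_Cons_iff [simp]: "is_child (i # p) (j # q) \<longleftrightarrow> i = j \<and> is_child p q"
  by (auto simp: is_child_def)

lemma is_child_Nil_iff: "is_child [] q \<longleftrightarrow> (\<exists>i. q = [i])"
  by (auto simp: is_child_def)

lemma not_is_child_Nil [simp]: "\<not> is_child p []"
  by (auto simp: is_child_def)

lemma snoc_in_vertsD: "p @ [a] \<in> verts T \<Longrightarrow> p \<in> verts T"
proof (induction p arbitrary: T)
  case (Cons i p)
  then show ?case by (cases T) auto
qed simp

lemma tree_iso_NodeI: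
  assumes "bij_betw \<sigma> {..<length ts} {..<length us}"
    and iso: "\<And>i. i < length ts \<Longrightarrow> tree_iso (ts ! i) (us ! \<sigma> i)"
  shows "tree_iso (Node ts) (Node us)"
proof -
  have "\<forall>i\<in>{..<length ts}. \<exists>f. bij_betw f (verts (ts ! i)) (verts (us ! \<sigma> i)) \<and> f [] = [] \<and>
      (\<forall>p \<in> verts (ts ! i). \<forall>q \<in> verts (ts ! i). is_child p q \<longleftrightarrow> is_child (f p) (f q))"
    using iso by (auto simp: tree_iso_def)
  from bchoice[OF this] obtain F where
    F: "\<And>i. i < length ts \<Longrightarrow> bij_betw (F i) (verts (ts ! i)) (verts (us ! \<sigma> i))"
    and F0: "\<And>i. i < length ts \<Longrightarrow> F i [] = []"
    and Fc: "\<And>i p q. \<lbrakk>i < length ts; p \<in> verts (ts ! i); q \<in> verts (ts ! i)\<rbrakk>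
        \<Longrightarrow> is_child p q \<longleftrightarrow> is_child (F i p) (F i q)"
    by auto
  have \<sigma>: "inj_on \<sigma> {..<length ts}" "\<sigma> ` {..<length ts} = {..<length us}"
    using assms(1) by (auto simp: bij_betw_def)
  \<comment> \<open>The bijections of the branches are glued together: \<open>\<sigma>\<close> moves
    the first position and \<open>F i\<close> acts on the rest of the path.\<close>
  define f where "f = (\<lambda>x. case x of [] \<Rightarrow> [] | i # p \<Rightarrow> \<sigma> i # F i p)"
  have fNil [simp]: "f [] = []" and fCons [simp]: "f (i # p) = \<sigma> i # F i p" for i p
    by (auto simp: f_def)
  have "bij_betw f (verts (Node ts)) (verts (Node us))"
  proof (rule bij_betw_imageI)
    show "inj_on f (verts (Node ts))"
    proof (rule inj_onI)
      fix x y assume x: "x \<in> verts (Node ts)" and y: "y \<in> verts (Node ts)" and eq: "f x = f y"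
      show "x = y"
      proof (cases x; cases y)
        fix i p j q assume [simp]: "x = i # p" "y = j # q"
        have "i = j" using eq x y \<sigma>(1) by (auto simp del: verts.simps simp: inj_on_def)
        moreover have "p = q" using eq x y F[of i] \<open>i = j\<close>
          by (auto simp del: verts.simps simp: bij_betw_def inj_on_def)
        ultimately show ?thesis by simp
      qed (use eq in auto)
    qed
    show "f ` verts (Node ts) = verts (Node us)"
    proof (intro equalityI subsetI)
      fix y assume "y \<in> f ` verts (Node ts)"
      then obtain x where x: "x \<in> verts (Node ts)" "y = f x" by blast
      show "y \<in> verts (Node us)"
      proof (cases x)
        case (Cons i p)
        then have "i < length ts" "p \<in> verts (ts ! i)" using x by auto
        then have "\<sigma> i < length us" "F i p \<in> verts (us ! \<sigma> i)"
          using \<sigma> F[of i] by (auto simp: bij_betw_def)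
        then show ?thesis using x Cons by (simp del: verts.simps)
      qed (use x in simp)
    next
      fix y assume y: "y \<in> verts (Node us)"
      show "y \<in> f ` verts (Node ts)"
      proof (cases y)
        case Nil
        then show ?thesis by (metis Nil_in_verts fNil imageI)
      next
        case (Cons j q)
        then have j: "j < length us" "q \<in> verts (us ! j)" using y by auto
        then obtain i where i: "i < length ts" "j = \<sigma> i" using \<sigma>(2) by (auto simp: set_eq_iff image_iff)
        then obtain p where "p \<in> verts (ts ! i)" "q = F i p" using j F[of i] by (auto simp: bij_betw_def)
        then have "i # p \<in> verts (Node ts)" "f (i # p) = y" using i Cons by auto
        then show ?thesis by blast
      qed
    qed
  qed
  moreover have "is_child p q \<longleftrightarrow> is_child (f p) (f q)"
    if pq: "p \<in> verts (Node ts)" "q \<in> verts (Node ts)" for p q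
  proof (cases q)
    case Nil
    then show ?thesis by simp
  next
    case q: (Cons j q')
    then have j: "j < length ts" "q' \<in> verts (ts ! j)" using pq by auto
    show ?thesis
    proof (cases p)
      case Nil
      have "q' = [] \<longleftrightarrow> F j q' = []"
        using F[OF j(1)] F0[OF j(1)] j Nil_in_verts by (metis bij_betw_def inj_on_def)
      then show ?thesis using Nil q by (auto simp: is_child_Nil_iff)
    next
      case p: (Cons i p')
      then have i: "i < length ts" "p' \<in> verts (ts ! i)" using pq by auto
      then show ?thesis using Fc[OF i(1)] i j \<sigma>(1) p q by (auto simp: inj_on_def)
    qed
  qed
  ultimately show ?thesis unfolding tree_iso_def using fNil by blast
qed

text \<open>An isomorphism fixes the root, so it permutes the positions just below it; as it
  preserves each edge of a path, everything below child \<open>i\<close> stays below the image of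
  \<open>i\<close>.\<close>

lemma tree_iso_NodeD:
  assumes "tree_iso (Node ts) (Node us)"
  shows "\<exists>\<sigma>. bij_betw \<sigma> {..<length ts} {..<length us} \<and> (\<forall>i<length ts. tree_iso (ts ! i) (us ! \<sigma> i))"
proof -
  obtain f where bij: "bij_betw f (verts (Node ts)) (verts (Node us))" and f0: "f [] = []"
    and fc: "\<And>p q. \<lbrakk>p \<in> verts (Node ts); q \<in> verts (Node ts)\<rbrakk> \<Longrightarrow> is_child p q \<longleftrightarrow> is_child (f p) (f q)"
    using assms unfolding tree_iso_def by blast
  have inj: "inj_on f (verts (Node ts))" and im: "f ` verts (Node ts) = verts (Node us)"
    using bij by (auto simp only: bij_betw_def)
  define \<sigma> where "\<sigma> i = hd (f [i])" for i
  define F where "F i p = tl (f (i # p))" for i p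
  \<comment> \<open>Induction along the path away from the root: each edge prolongs the image by one
    position, hence the first position of the image never changes.\<close>
  have f1: "f (i # p) = \<sigma> i # F i p" if "i < length ts" "p \<in> verts (ts ! i)" for i p
    using that
  proof (induction p rule: rev_induct)
    case Nil
    then have "is_child [] (f [i])" using fc[of "[]" "[i]"] f0 by (auto simp: is_child_Nil_iff simp del: verts.simps)
    then show ?case by (auto simp: is_child_Nil_iff \<sigma>_def F_def)
  next
    case (snoc a p)
    then have p: "p \<in> verts (ts ! i)" by (blast dest: snoc_in_vertsD)
    then have "is_child (f (i # p)) (f (i # p @ [a]))"
      using fc[of "i # p" "i # p @ [a]"] snoc.prems by (auto simp: is_child_def simp del: verts.simps)
    then obtain b where "f (i # p @ [a]) = (\<sigma> i # F i p) @ [b]" using snoc p by (auto simp: is_child_def)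
    then show ?case unfolding F_def by simp
  qed
  have F0: "F i [] = []" if "i < length ts" for i
    using fc[of "[]" "[i]"] f0 that f1[OF that, of "[]"] by (auto simp: is_child_Nil_iff simp del: verts.simps)
  have img: "\<sigma> i < length us \<and> F i p \<in> verts (us ! \<sigma> i)" if "i < length ts" "p \<in> verts (ts ! i)" for i p
  proof -
    have "f (i # p) \<in> verts (Node us)" using im that by (metis Cons_in_verts_iff imageI)
    then show ?thesis using f1[OF that] by (simp del: verts.simps)
  qed
  have \<sigma>inj: "inj_on \<sigma> {..<length ts}"
  proof (rule inj_onI)
    fix i j assume ij: "i \<in> {..<length ts}" "j \<in> {..<length ts}" "\<sigma> i = \<sigma> j"
    then have "f [i] = f [j]" using f1[of i "[]"] f1[of j "[]"] F0 by auto
    then show "i = j" using inj ij unfolding inj_on_def by (metis Cons_in_verts_iff Nil_in_verts lessThan_iff list.inject)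
  qed
  have pre: "\<exists>i p. i < length ts \<and> p \<in> verts (ts ! i) \<and> j = \<sigma> i \<and> q = F i p"
    if jq: "j < length us" "q \<in> verts (us ! j)" for j q
  proof -
    have "j # q \<in> f ` verts (Node ts)" using jq unfolding im by (simp del: verts.simps)
    then obtain x where x: "x \<in> verts (Node ts)" "j # q = f x" by blast
    then obtain i p where ip: "x = i # p" using f0 by (cases x) auto
    then have "i < length ts" "p \<in> verts (ts ! i)" using x by auto
    then show ?thesis using f1[of i p] x ip by auto
  qed
  have "bij_betw \<sigma> {..<length ts} {..<length us}"
    unfolding bij_betw_def
  proof (intro conjI equalityI subsetI \<sigma>inj)
    fix j assume "j \<in> \<sigma> ` {..<length ts}" then show "j \<in> {..<length us}" using img[of _ "[]"] by auto
  next
    fix j assume "j \<in> {..<length us}" then show "j \<in> \<sigma> ` {..<length ts}" using pre[of j "[]"] by auto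
  qed
  moreover have "tree_iso (ts ! i) (us ! \<sigma> i)" if i: "i < length ts" for i
    unfolding tree_iso_def
  proof (intro exI conjI ballI)
    show "bij_betw (F i) (verts (ts ! i)) (verts (us ! \<sigma> i))"
    proof (rule bij_betw_imageI)
      show "inj_on (F i) (verts (ts ! i))"
      proof (rule inj_onI)
        fix p q assume pq: "p \<in> verts (ts ! i)" "q \<in> verts (ts ! i)" "F i p = F i q"
        then have "f (i # p) = f (i # q)" using f1 i by auto
        then show "p = q" using inj i pq unfolding inj_on_def by (metis Cons_in_verts_iff list.inject)
      qed
      show "F i ` verts (ts ! i) = verts (us ! \<sigma> i)"
      proof (intro equalityI subsetI)
        fix q assume "q \<in> verts (us ! \<sigma> i)"
        then obtain i' p where "i' < length ts" "p \<in> verts (ts ! i')" "\<sigma> i = \<sigma> i'" "q = F i' p"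
          using pre[of "\<sigma> i" q] img[OF i, of "[]"] by auto
        then show "q \<in> F i ` verts (ts ! i)" using \<sigma>inj i by (auto simp: inj_on_def)
      qed (use img i in auto)
    qed
    show "F i [] = []" by (rule F0[OF i])
    fix p q assume pq: "p \<in> verts (ts ! i)" "q \<in> verts (ts ! i)"
    then show "is_child p q \<longleftrightarrow> is_child (F i p) (F i q)"
      using fc[of "i # p" "i # q"] i f1[OF i] by (simp del: verts.simps)
  qed
  ultimately show ?thesis by blast
qed

lemma image_mset_lessThan_length: "image_mset (\<lambda>i. f (xs ! i)) (mset_set {..<length xs}) = mset (map f xs)"
proof -
  have "mset (map f xs) = mset (map (\<lambda>i. f (xs ! i)) [0..<length xs])"
    by (subst (1) map_nth[symmetric]) (simp only: map_map comp_def)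
  then show ?thesis by (simp add: atLeast0LessThan)
qed

text \<open>By induction, pairing the branches of two roots isomorphically means pairing equal
  canonical forms, and such a pairing exists exactly when the two multisets of canonical forms
  agree.\<close>

lemma tree_iso_iff_canon: "tree_iso T U \<longleftrightarrow> canon T = canon U"
proof (induction T arbitrary: U)
  case (Node ts)
  obtain us where U: "U = Node us" by (cases U)
  show ?case
  proof
    assume "tree_iso (Node ts) U"
    then obtain \<sigma> where \<sigma>: "bij_betw \<sigma> {..<length ts} {..<length us}"
      and iso: "\<And>i. i < length ts \<Longrightarrow> tree_iso (ts ! i) (us ! \<sigma> i)"
      using tree_iso_NodeD U by blast
    have "mset (map canon ts) = image_mset (\<lambda>i. canon (us ! \<sigma> i)) (mset_set {..<length ts})"
      unfolding image_mset_lessThan_length[symmetric]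
      using iso Node.IH by (intro image_mset_cong) auto
    also have "\<dots> = image_mset (\<lambda>i. canon (us ! i)) (image_mset \<sigma> (mset_set {..<length ts}))"
      by (simp add: image_mset.compositionality comp_def)
    also have "image_mset \<sigma> (mset_set {..<length ts}) = mset_set {..<length us}"
      using \<sigma> by (metis bij_betw_def image_mset_mset_set)
    finally show "canon (Node ts) = canon U" using U by (simp add: image_mset_lessThan_length)
  next
    assume eq: "canon (Node ts) = canon U"
    then have ms: "mset (map canon ts) = mset (map canon us)" using U by simp
    then obtain p where p: "p permutes {..<length us}" "permute_list p (map canon us) = map canon ts"
      using mset_eq_permutation by (metis length_map)
    have len: "length ts = length us" using ms by (metis length_map size_mset)
    have "tree_iso (ts ! i) (us ! p i)" if "i < length ts" for i
    proof -
      have "map canon ts ! i = map canon us ! p i"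
        using p that len by (metis permute_list_nth length_map)
      moreover have "p i < length us" using p(1) that len by (metis lessThan_iff permutes_in_image)
      ultimately show ?thesis using Node.IH that by simp
    qed
    then show "tree_iso (Node ts) U"
      unfolding U using p(1) len by (intro tree_iso_NodeI[of p]) (auto simp: permutes_imp_bij)
  qed
qed

subsection \<open>Leaf sets and the shapes they induce\<close>

lemma finite_verts [simp]: "finite (verts T)"
  by (induction T) (auto intro!: finite_imageI)

lemma finite_leaves [simp]: "finite (leaves T)"
  unfolding leaves_def by (rule finite_subset[OF _ finite_verts[of T]]) auto

lemma Nil_in_leaves_iff [simp]: "[] \<in> leaves (Node ts) \<longleftrightarrow> ts = []"
proof
  assume "[] \<in> leaves (Node ts)"
  then have "\<not> is_child [] [0]" if "[0] \<in> verts (Node ts)" using that unfolding leaves_def by blast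
  then have "[0] \<notin> verts (Node ts)" by (auto simp only: is_child_Nil_iff)
  then show "ts = []" by (simp del: verts.simps)
qed (simp add: leaves_def)

lemma Cons_in_leaves_iff [simp]: "i # p \<in> leaves (Node ts) \<longleftrightarrow> i < length ts \<and> p \<in> leaves (ts ! i)"
proof -
  have "(\<exists>q\<in>verts (Node ts). is_child (i # p) q) \<longleftrightarrow> (\<exists>q\<in>verts (ts ! i). is_child p q)" if "i < length ts"
  proof
    assume "\<exists>q\<in>verts (Node ts). is_child (i # p) q"
    then obtain q where q: "q \<in> verts (Node ts)" "is_child (i # p) q" by blast
    then obtain q' where "q = i # q'" by (auto simp: is_child_def)
    then show "\<exists>q\<in>verts (ts ! i). is_child p q" using q by (auto simp del: verts.simps)
  next
    assume "\<exists>q\<in>verts (ts ! i). is_child p q"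
    then obtain q where "q \<in> verts (ts ! i)" "is_child p q" by blast
    then show "\<exists>q\<in>verts (Node ts). is_child (i # p) q"
      using that by (intro bexI[of _ "i # q"]) (auto simp del: verts.simps)
  qed
  then show ?thesis unfolding leaves_def by (auto simp del: verts.simps)
qed

lemma leaves_Leaf [simp]: "leaves (Node []) = {[]}"
  by (auto simp: leaves_def)

section \<open>Splitting a leaf set among the branches of the root\<close>

definition branch :: "nat \<Rightarrow> nat list set \<Rightarrow> nat list set" where
  "branch i S = {p. i # p \<in> S}"

lemma branch_leaves: "i < length ts \<Longrightarrow> branch i (leaves (Node ts)) = leaves (ts ! i)"
  by (auto simp: branch_def)

lemma branch_empty [simp]: "branch i {} = {}"
  by (simp add: branch_def)

lemma branch_mono: "S \<subseteq> S' \<Longrightarrow> branch i S \<subseteq> branch i S'"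
  by (auto simp: branch_def)

lemma branch_subset_leaves:
  "\<lbrakk>S \<subseteq> leaves (Node ts); i < length ts\<rbrakk> \<Longrightarrow> branch i S \<subseteq> leaves (ts ! i)"
  using branch_mono branch_leaves by metis

text \<open>The condition \<open>ts \<noteq> []\<close> sets aside the one-vertex tree, whose leaf
  is the path \<open>[]\<close> and lies in no branch.\<close>

lemma decompose_leaf_set:
  assumes "S \<subseteq> leaves (Node ts)" "ts \<noteq> []"
  shows "S = (\<Union>i<length ts. (#) i ` branch i S)"
proof (intro equalityI subsetI)
  fix x assume x: "x \<in> S"
  then have "x \<noteq> []" using assms by auto
  then obtain i p where "x = i # p" by (cases x) auto
  with x assms have "i < length ts" "p \<in> branch i S" by (auto simp: branch_def)
  with \<open>x = i # p\<close> show "x \<in> (\<Union>i<length ts. (#) i ` branch i S)" by blast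
qed (auto simp: branch_def)

lemma card_leaf_set:
  assumes "S \<subseteq> leaves (Node ts)" "ts \<noteq> []"
  shows "card S = (\<Sum>i<length ts. card (branch i S))"
proof -
  have fin: "finite (branch i S)" if "i < length ts" for i
    using branch_subset_leaves[OF assms(1) that] finite_leaves finite_subset by blast
  have "card S = card (\<Union>i<length ts. (#) i ` branch i S)"
    by (rule arg_cong[OF decompose_leaf_set[OF assms]])
  also have "\<dots> = (\<Sum>i<length ts. card ((#) i ` branch i S))"
    using fin by (subst card_UN_disjoint) auto
  also have "\<dots> = (\<Sum>i<length ts. card (branch i S))"
    by (simp add: card_image)
  finally show ?thesis .
qed

lemma num_leaves_Leaf [simp]: "num_leaves (Node []) = 1"
  by (simp add: num_leaves_def)

lemma num_leaves_Node: "ts \<noteq> [] \<Longrightarrow> num_leaves (Node ts) = (\<Sum>i<length ts. num_leaves (ts ! i))"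
  unfolding num_leaves_def by (subst card_leaf_set[OF order_refl]) (auto simp: branch_leaves)

text \<open>Leaf sets of the branches can be chosen independently; this is the source of the
  products in \<open>occ_Node\<close>.\<close>

lemma bij_betw_branches:
  assumes "ts \<noteq> []"
  shows "bij_betw (\<lambda>S. \<lambda>i\<in>{..<length ts}. branch i S) (Pow (leaves (Node ts)))
           (PiE {..<length ts} (\<lambda>i. Pow (leaves (ts ! i))))"
proof (rule bij_betw_byWitness[where f' = "\<lambda>g. \<Union>i<length ts. (#) i ` g i"])
  show "\<forall>S\<in>Pow (leaves (Node ts)). (\<Union>i<length ts. (#) i ` (\<lambda>i\<in>{..<length ts}. branch i S) i) = S"
  proof
    fix S assume "S \<in> Pow (leaves (Node ts))"
    then show "(\<Union>i<length ts. (#) i ` (\<lambda>i\<in>{..<length ts}. branch i S) i) = S"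
      by (subst (2) decompose_leaf_set[OF _ assms]) auto
  qed
  show "\<forall>g\<in>PiE {..<length ts} (\<lambda>i. Pow (leaves (ts ! i))).
      (\<lambda>i\<in>{..<length ts}. branch i (\<Union>i<length ts. (#) i ` g i)) = g"
    by (auto simp: fun_eq_iff restrict_def branch_def PiE_iff extensional_def)
  show "(\<lambda>S. \<lambda>i\<in>{..<length ts}. branch i S) ` Pow (leaves (Node ts))
      \<subseteq> PiE {..<length ts} (\<lambda>i. Pow (leaves (ts ! i)))"
    using branch_subset_leaves by (auto simp: subset_iff)
  show "(\<lambda>g. \<Union>i<length ts. (#) i ` g i) ` PiE {..<length ts} (\<lambda>i. Pow (leaves (ts ! i)))
      \<subseteq> Pow (leaves (Node ts))"
    by (auto simp: PiE_iff subset_iff)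
qed

section \<open>Shapes of induced trees\<close>

definition shape :: "nat list set \<Rightarrow> tree \<Rightarrow> mtree" where
  "shape S T = canon (induced_tree S T)"

text \<open>The effect of \<open>suppress\<close> at a root, on isomorphism classes: a lone branch
  takes the place of the root. The empty multiset gives \<open>MNode {#}\<close>, a single
  leaf.\<close>

definition merge :: "mtree multiset \<Rightarrow> mtree" where
  "merge B = (if size B = 1 then THE M. B = {#M#} else MNode B)"

lemma merge_single [simp]: "merge {#M#} = M"
  by (simp add: merge_def)

lemma merge_not_single: "size B \<noteq> 1 \<Longrightarrow> merge B = MNode B"
  by (simp add: merge_def)

lemma canon_suppress_Node: "canon (suppress (Node ts)) = merge (mset (map (\<lambda>t. canon (suppress t)) ts))"
proof (cases ts)
  case (Cons t ts')
  then show ?thesis by (cases ts') (auto simp: merge_not_single comp_def)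
qed (simp add: merge_not_single)

lemma shape_Node:
  "shape S (Node ts) = merge (image_mset (\<lambda>i. shape (branch i S) (ts ! i))
     (filter_mset (\<lambda>i. branch i S \<noteq> {}) (mset_set {..<length ts})))"
proof -
  have br: "(\<exists>p. i # p \<in> S) \<longleftrightarrow> branch i S \<noteq> {}" for i by (auto simp: branch_def)
  have "shape S (Node ts) = merge (image_mset (\<lambda>i. shape (branch i S) (ts ! i))
      (mset (filter (\<lambda>i. branch i S \<noteq> {}) [0..<length ts])))"
    unfolding shape_def induced_tree_def span_tree.simps canon_suppress_Node br
    by (simp add: branch_def image_mset.compositionality comp_def)
  then show ?thesis by (simp add: atLeast0LessThan)
qed

text \<open>For \<open>S = {}\<close> the value of \<open>shape\<close> would be a single leaf, as
  for a one-element set. \<open>None\<close> keeps the two apart, so that a branch without chosen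
  leaves is recognizable.\<close>

definition oshape :: "nat list set \<Rightarrow> tree \<Rightarrow> mtree option" where
  "oshape S T = (if S = {} then None else Some (shape S T))"

definition somes :: "(nat \<Rightarrow> mtree option) \<Rightarrow> nat \<Rightarrow> mtree multiset" where
  "somes f n = image_mset (\<lambda>i. the (f i)) (filter_mset (\<lambda>i. f i \<noteq> None) (mset_set {..<n}))"

definition omerge :: "mtree multiset \<Rightarrow> mtree option" where
  "omerge B = (if B = {#} then None else Some (merge B))"

lemma somes_cong: "(\<And>i. i < n \<Longrightarrow> f i = g i) \<Longrightarrow> somes f n = somes g n"
proof -
  assume "\<And>i. i < n \<Longrightarrow> f i = g i"
  then have "filter_mset (\<lambda>i. f i \<noteq> None) (mset_set {..<n}) = filter_mset (\<lambda>i. g i \<noteq> None) (mset_set {..<n})"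
    by (intro filter_mset_cong) auto
  then show ?thesis unfolding somes_def using \<open>\<And>i. i < n \<Longrightarrow> f i = g i\<close> by (auto intro: image_mset_cong)
qed

lemma oshape_Node:
  assumes "S \<subseteq> leaves (Node ts)" "ts \<noteq> []"
  shows "oshape S (Node ts) = omerge (somes (\<lambda>i. oshape (branch i S) (ts ! i)) (length ts))"
proof -
  have "image_mset (\<lambda>i. shape (branch i S) (ts ! i))
      (filter_mset (\<lambda>i. branch i S \<noteq> {}) (mset_set {..<length ts}))
    = somes (\<lambda>i. oshape (branch i S) (ts ! i)) (length ts)" (is "?B = ?B'")
  proof -
    have "filter_mset (\<lambda>i. oshape (branch i S) (ts ! i) \<noteq> None) (mset_set {..<length ts})
        = filter_mset (\<lambda>i. branch i S \<noteq> {}) (mset_set {..<length ts})"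
      by (intro filter_mset_cong) (auto simp: oshape_def)
    then show ?thesis unfolding somes_def by (simp only:) (rule image_mset_cong, auto simp: oshape_def)
  qed
  moreover have "S = {} \<longleftrightarrow> ?B = {#}"
  proof -
    have "S = {} \<longleftrightarrow> (\<forall>i<length ts. branch i S = {})"
    proof
      assume "\<forall>i<length ts. branch i S = {}"
      then have "(\<Union>i<length ts. (#) i ` branch i S) = {}" by simp
      then show "S = {}" using decompose_leaf_set[OF assms] by argo
    qed simp
    then show ?thesis by (auto simp flip: set_mset_eq_empty_iff)
  qed
  ultimately show ?thesis by (simp add: oshape_def omerge_def shape_Node)
qed

section \<open>Leaf numbers of shapes, and shapes without unary vertices\<close>

primrec mleaves :: "mtree \<Rightarrow> nat" where
  "mleaves (MNode B) = (if B = {#} then 1 else sum_mset (image_mset mleaves B))"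

definition oleaves :: "mtree option \<Rightarrow> nat" where
  "oleaves x = (case x of None \<Rightarrow> 0 | Some M \<Rightarrow> mleaves M)"

lemma oleaves_simps [simp]: "oleaves None = 0" "oleaves (Some M) = mleaves M"
  by (auto simp: oleaves_def)

lemma mleaves_pos: "mleaves M > 0"
proof (induction M)
  case (MNode B)
  show ?case
  proof (cases "B = {#}")
    case False
    then obtain M where "M \<in># B" by blast
    then show ?thesis using MNode by (auto dest: multi_member_split)
  qed simp
qed

lemma oleaves_omerge: "oleaves (omerge B) = (\<Sum>M\<in>#B. mleaves M)"
proof (cases "size B = 1")
  case True
  then show ?thesis using size_1_singleton_mset by (force simp: omerge_def)
qed (auto simp: omerge_def merge_not_single)

lemma sum_somes: "(\<Sum>M\<in>#somes f n. mleaves M) = (\<Sum>i<n. oleaves (f i))"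
proof -
  have "(\<Sum>M\<in>#somes f n. mleaves M) = (\<Sum>i\<in>{i\<in>{..<n}. f i \<noteq> None}. mleaves (the (f i)))"
    by (simp add: somes_def image_mset.compositionality comp_def sum_unfold_sum_mset)
  also have "\<dots> = (\<Sum>i<n. oleaves (f i))"
    by (intro sum.mono_neutral_cong_left) (auto simp: oleaves_def split: option.splits)
  finally show ?thesis .
qed

text \<open>Merging preserves the number of leaves. So the shape of a nonempty leaf set determines
  its size, and the cardinality condition in \<open>copies\<close> follows from the isomorphism for
  such sets.\<close>

lemma oleaves_oshape: "S \<subseteq> leaves T \<Longrightarrow> oleaves (oshape S T) = card S"
proof (induction T arbitrary: S)
  case (Node ts)
  show ?case
  proof (cases "ts = []")
    case True
    then have "S = {} \<or> S = {[]}" using Node.prems by auto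
    then show ?thesis using True by (auto simp: oshape_def shape_Node merge_not_single)
  next
    case False
    have "oleaves (oshape S (Node ts)) = (\<Sum>i<length ts. oleaves (oshape (branch i S) (ts ! i)))"
      by (simp add: oshape_Node[OF Node.prems False] oleaves_omerge sum_somes)
    also have "\<dots> = (\<Sum>i<length ts. card (branch i S))"
      using branch_subset_leaves[OF Node.prems] by (intro sum.cong refl Node.IH) auto
    also have "\<dots> = card S" using card_leaf_set[OF Node.prems False] by simp
    finally show ?thesis .
  qed
qed

lemma mleaves_canon: "mleaves (canon T) = num_leaves T"
proof (induction T)
  case (Node ts)
  show ?case
  proof (cases "ts = []")
    case False
    have "mleaves (canon (Node ts)) = (\<Sum>i<length ts. mleaves (canon (ts ! i)))"
      using False by (simp add: image_mset_lessThan_length[of canon ts, symmetric] sum_unfold_sum_mset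
          image_mset.compositionality comp_def mset_set_empty_iff lessThan_empty_iff bot_nat_def
          del: mset_map)
    then show ?thesis using False Node.IH by (simp add: num_leaves_Node del: canon.simps)
  qed simp
qed

text \<open>Holds for \<open>d\<close>-ary trees and for all induced shapes. The quantifier runs
  over \<open>image_mset no_unary B\<close> to fit primitive recursion through a multiset.\<close>

primrec no_unary :: "mtree \<Rightarrow> bool" where
  "no_unary (MNode B) \<longleftrightarrow> size B \<noteq> 1 \<and> (\<forall>b\<in>#image_mset no_unary B. b)"

lemma no_unary_merge: "(\<And>M. M \<in># B \<Longrightarrow> no_unary M) \<Longrightarrow> no_unary (merge B)"
proof (cases "size B = 1")
  case True
  then show "(\<And>M. M \<in># B \<Longrightarrow> no_unary M) \<Longrightarrow> no_unary (merge B)" using size_1_singleton_mset by force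
qed (auto simp: merge_not_single)

lemma no_unary_shape: "no_unary (shape S T)"
proof (induction T arbitrary: S)
  case (Node ts)
  then show ?case unfolding shape_Node by (intro no_unary_merge) auto
qed

lemma no_unary_canon: "dary d T \<Longrightarrow> no_unary (canon T)"
  by (induction T) auto

subsection \<open>Counting leaf sets of a given shape\<close>

text \<open>The argument \<open>None\<close> counts only the empty set, so an untouched branch
  contributes the factor 1 to a product over all branches.\<close>

definition occ :: "mtree option \<Rightarrow> tree \<Rightarrow> nat" where
  "occ x T = card {S. S \<subseteq> leaves T \<and> oshape S T = x}"

lemma occ_None [simp]: "occ None T = 1"
proof -
  have "{S. S \<subseteq> leaves T \<and> oshape S T = None} = {{}}" by (auto simp: oshape_def)
  then show ?thesis by (simp add: occ_def)
qed

lemma copies_eq_occ: "copies D T = occ (Some (canon D)) T"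
proof -
  have "S \<subseteq> leaves T \<and> card S = num_leaves D \<and> tree_iso (induced_tree S T) D
      \<longleftrightarrow> S \<subseteq> leaves T \<and> oshape S T = Some (canon D)" for S
  proof (cases "S \<subseteq> leaves T \<and> S \<noteq> {}")
    case True
    then have "card S = mleaves (shape S T)" using oleaves_oshape[of S T] by (auto simp: oshape_def)
    then show ?thesis using True
      by (auto simp: oshape_def shape_def tree_iso_iff_canon mleaves_canon[symmetric])
  next
    case False
    have "num_leaves D > 0" using mleaves_pos mleaves_canon by metis
    then show ?thesis using False by (auto simp: oshape_def)
  qed
  then show ?thesis by (simp add: copies_def occ_def)
qed

lemma mleaves_eq_1: "no_unary M \<Longrightarrow> mleaves M = 1 \<longleftrightarrow> M = MNode {#}"
proof (cases M)
  case (MNode B)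
  assume "no_unary M"
  show ?thesis
  proof (cases B rule: multiset_cases)
    case (add M1 B1)
    then obtain M2 B2 where "B1 = add_mset M2 B2" using \<open>no_unary M\<close> MNode
      by (cases B1 rule: multiset_cases) auto
    then show ?thesis using MNode add mleaves_pos[of M1] mleaves_pos[of M2] by auto
  qed (use MNode in auto)
qed

text \<open>Every branch has a leaf and an internal root has at least two branches, so two leaves
  leave room for exactly two branches of one leaf each.\<close>

lemma mleaves_eq_2:
  assumes "no_unary M"
  shows "mleaves M = 2 \<longleftrightarrow> M = MNode {#MNode {#}, MNode {#}#}"
proof (cases M)
  case (MNode B)
  show ?thesis
  proof (cases B rule: multiset_cases)
    case (add M1 B1)
    then obtain M2 B2 where B1: "B1 = add_mset M2 B2" using \<open>no_unary M\<close> MNode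
      by (cases B1 rule: multiset_cases) auto
    have nu: "no_unary M1" "no_unary M2" using assms MNode add B1 by auto
    show ?thesis
    proof (cases B2 rule: multiset_cases)
      case empty
      then show ?thesis using MNode add B1 mleaves_pos[of M1] mleaves_pos[of M2]
          mleaves_eq_1[OF nu(1)] mleaves_eq_1[OF nu(2)] by (auto simp: add_eq_conv_ex)
    next
      case (add M3 B3)
      then show ?thesis using MNode \<open>B = add_mset M1 B1\<close> B1 mleaves_pos[of M1] mleaves_pos[of M2]
        mleaves_pos[of M3] by (auto simp: add_eq_conv_ex)
    qed
  qed (use MNode in auto)
qed

text \<open>If no other shape has that many leaves, every leaf set of the right size induces
  \<open>M\<close>. This is applied to the shapes with one or two leaves.\<close>

lemma occ_eq_choose:
  assumes "no_unary M" and unique: "\<And>M'. no_unary M' \<Longrightarrow> mleaves M' = mleaves M \<Longrightarrow> M' = M"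
  shows "occ (Some M) T = num_leaves T choose mleaves M"
proof -
  have "{S. S \<subseteq> leaves T \<and> oshape S T = Some M} = {S. S \<subseteq> leaves T \<and> card S = mleaves M}"
  proof (intro Collect_cong conj_cong refl)
    fix S assume S: "S \<subseteq> leaves T"
    show "oshape S T = Some M \<longleftrightarrow> card S = mleaves M"
    proof (cases "S = {}")
      case True
      then show ?thesis using mleaves_pos[of M] by (auto simp: oshape_def)
    next
      case False
      then have "card S = mleaves (shape S T)" using oleaves_oshape[OF S] by (auto simp: oshape_def)
      then show ?thesis using False unique[OF no_unary_shape] by (auto simp: oshape_def)
    qed
  qed
  then show ?thesis by (simp add: occ_def num_leaves_def n_subsets)
qed

lemma occ_le_choose: "occ (Some M) T \<le> num_leaves T choose mleaves M"
proof -
  have "{S. S \<subseteq> leaves T \<and> oshape S T = Some M} \<subseteq> {S. S \<subseteq> leaves T \<and> card S = mleaves M}"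
  proof clarify
    fix S assume "S \<subseteq> leaves T" "oshape S T = Some M"
    then show "card S = mleaves M" using oleaves_oshape[of S T] by simp
  qed
  then have "occ (Some M) T \<le> card {S. S \<subseteq> leaves T \<and> card S = mleaves M}"
    unfolding occ_def by (intro card_mono) auto
  then show ?thesis by (simp add: num_leaves_def n_subsets)
qed

text \<open>\<open>f i\<close> prescribes the shape to be induced in branch \<open>i\<close>.
  Extensionality identifies functions that agree below \<open>n\<close>, which keeps the set finite
  and avoids double counting.\<close>

definition splittings :: "mtree option \<Rightarrow> nat \<Rightarrow> (nat \<Rightarrow> mtree option) set" where
  "splittings x n = {f \<in> extensional {..<n}. omerge (somes f n) = x}"

lemma somes_memI: "\<lbrakk>f i = Some M; i < n\<rbrakk> \<Longrightarrow> M \<in># somes f n"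
  by (force simp: somes_def)

lemma finite_splittings: "finite (splittings x n)"
proof -
  \<comment> \<open>The possible values of \<open>f i\<close>: nothing, all of \<open>x\<close> when
    one branch contains everything, or a branch of \<open>x\<close>.\<close>
  define A where "A = insert None (insert x (case x of None \<Rightarrow> {} | Some M \<Rightarrow> (case M of MNode B \<Rightarrow> Some ` set_mset B)))"
  have "f i \<in> A" if f: "f \<in> splittings x n" and i: "i < n" for f i
  proof (cases "f i")
    case (Some M)
    then have M: "M \<in># somes f n" using i by (rule somes_memI)
    then have x: "x = Some (merge (somes f n))" using f by (auto simp: splittings_def omerge_def)
    show ?thesis
    proof (cases "size (somes f n) = 1")
      case True
      then obtain M' where "somes f n = {#M'#}" using size_1_singleton_mset by blast
      then show ?thesis using M x Some by (auto simp: A_def)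
    next
      case False
      then show ?thesis using M x Some by (auto simp: A_def merge_not_single)
    qed
  qed (simp add: A_def)
  moreover have "splittings x n \<subseteq> extensional {..<n}" by (auto simp: splittings_def)
  ultimately have "splittings x n \<subseteq> PiE {..<n} (\<lambda>_. A)"
    unfolding PiE_def Pi_def by blast
  moreover have "finite (PiE {..<n} (\<lambda>_. A))"
    by (intro finite_PiE) (auto simp: A_def split: option.splits mtree.splits)
  ultimately show ?thesis by (rule finite_subset)
qed

lemma sum_oleaves_splittings: "f \<in> splittings x n \<Longrightarrow> (\<Sum>i<n. oleaves (f i)) = oleaves x"
  using oleaves_omerge sum_somes by (metis (mono_tags, lifting) mem_Collect_eq splittings_def)

text \<open>Leaf sets are sorted by the shapes they induce in the branches. Once the splitting
  \<open>f\<close> is fixed, the choices in the branches are independent, whence the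
  product.\<close>

lemma occ_Node:
  assumes "ts \<noteq> []"
  shows "occ x (Node ts) = (\<Sum>f\<in>splittings x (length ts). \<Prod>i<length ts. occ (f i) (ts ! i))"
proof -
  define n where "n = length ts"
  define P where "P f = PiE {..<n} (\<lambda>i. {S. S \<subseteq> leaves (ts ! i) \<and> oshape S (ts ! i) = f i})" for f
  define G where "G = {g \<in> PiE {..<n} (\<lambda>i. Pow (leaves (ts ! i))).
    omerge (somes (\<lambda>i. oshape (g i) (ts ! i)) n) = x}"
  let ?b = "\<lambda>S. \<lambda>i\<in>{..<n}. branch i S"
  have "bij_betw ?b {S \<in> Pow (leaves (Node ts)). oshape S (Node ts) = x} G"
    unfolding G_def
  proof (rule bij_betw_Collect)
    show "bij_betw ?b (Pow (leaves (Node ts))) (PiE {..<n} (\<lambda>i. Pow (leaves (ts ! i))))"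
      unfolding n_def by (rule bij_betw_branches[OF assms])
    fix S assume "S \<in> Pow (leaves (Node ts))"
    then have "oshape S (Node ts) = omerge (somes (\<lambda>i. oshape (branch i S) (ts ! i)) n)"
      unfolding n_def by (intro oshape_Node assms) auto
    also have "somes (\<lambda>i. oshape (branch i S) (ts ! i)) n = somes (\<lambda>i. oshape (?b S i) (ts ! i)) n"
      by (intro somes_cong) auto
    finally show "omerge (somes (\<lambda>i. oshape (?b S i) (ts ! i)) n) = x \<longleftrightarrow> oshape S (Node ts) = x" by simp
  qed
  then have "occ x (Node ts) = card G"
    unfolding occ_def using bij_betw_same_card by fastforce
  also have "G = (\<Union>f\<in>splittings x n. P f)"
  proof (intro equalityI subsetI)
    fix g assume g: "g \<in> G"
    define f where "f = (\<lambda>i\<in>{..<n}. oshape (g i) (ts ! i))"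
    have "somes f n = somes (\<lambda>i. oshape (g i) (ts ! i)) n" by (intro somes_cong) (auto simp: f_def)
    then have "f \<in> splittings x n" using g by (auto simp: splittings_def G_def f_def)
    moreover have "g \<in> P f" using g by (auto simp: P_def G_def f_def PiE_iff)
    ultimately show "g \<in> (\<Union>f\<in>splittings x n. P f)" by blast
  next
    fix g assume "g \<in> (\<Union>f\<in>splittings x n. P f)"
    then obtain f where f: "f \<in> splittings x n" "g \<in> P f" by blast
    have "somes f n = somes (\<lambda>i. oshape (g i) (ts ! i)) n"
      using f by (intro somes_cong) (auto simp: P_def PiE_iff)
    then show "g \<in> G" using f by (auto simp: G_def P_def splittings_def PiE_iff)
  qed
  also have "card \<dots> = (\<Sum>f\<in>splittings x n. card (P f))"
  proof (rule card_UN_disjoint)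
    show "\<forall>f\<in>splittings x n. finite (P f)"
      unfolding P_def by (intro ballI finite_PiE) auto
    show "\<forall>f\<in>splittings x n. \<forall>f'\<in>splittings x n. f \<noteq> f' \<longrightarrow> P f \<inter> P f' = {}"
    proof (intro ballI impI)
      fix f f' assume f: "f \<in> splittings x n" "f' \<in> splittings x n" "f \<noteq> f'"
      \<comment> \<open>Both functions are \<open>undefined\<close> outside \<open>{..<n}\<close>,
        so they must differ at an index below \<open>n\<close>.\<close>
      then obtain i where "f i \<noteq> f' i" by blast
      then have "i < n" using f by (auto simp: splittings_def extensional_def not_less)
      then show "P f \<inter> P f' = {}" using \<open>f i \<noteq> f' i\<close> by (auto simp: P_def PiE_iff)
    qed
  qed (rule finite_splittings)
  also have "\<dots> = (\<Sum>f\<in>splittings x n. \<Prod>i<n. occ (f i) (ts ! i))"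
    by (simp add: P_def card_PiE occ_def)
  finally show ?thesis by (simp add: n_def)
qed

subsection \<open>The upper bound\<close>

fun graft :: "tree \<Rightarrow> tree \<Rightarrow> tree" where
  "graft U (Node ts) = (if ts = [] then U else Node (map (graft U) ts))"

lemma dary_graft: "\<lbrakk>dary d T; dary d U\<rbrakk> \<Longrightarrow> dary d (graft U T)"
  by (induction T) auto

lemma num_leaves_graft: "num_leaves (graft U T) = num_leaves T * num_leaves U"
proof (induction T)
  case (Node ts)
  then show ?case
    by (cases "ts = []") (simp_all add: num_leaves_Node sum_distrib_right)
qed

text \<open>The witness is a caterpillar: a new root joins a single leaf to the tree built so far.
  It supplies trees for grafting and shows that the maxima in \<open>inducibility\<close> range over
  nonempty sets for \<open>n \<ge> 1\<close>.\<close>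

lemma ex_dary_tree: "n \<ge> 1 \<Longrightarrow> d \<ge> 2 \<Longrightarrow> \<exists>T. dary d T \<and> num_leaves T = n"
proof (induction n rule: nat_induct_at_least)
  case base
  then show ?case by (intro exI[of _ "Node []"]) simp
next
  case (Suc n)
  then obtain T where "dary d T" "num_leaves T = n" by blast
  then show ?case using Suc.prems
    by (intro exI[of _ "Node [Node [], T]"]) (simp add: num_leaves_Node lessThan_Suc)
qed

lemma occ_Leaf: "occ x (Node []) = (if x = None \<or> x = Some (MNode {#}) then 1 else 0)"
proof -
  have sh: "oshape {[]} (Node []) = Some (MNode {#})"
    by (simp add: oshape_def shape_Node merge_not_single)
  have "{S. S \<subseteq> leaves (Node []) \<and> oshape S (Node []) = x}
      = (if x = None then {{}} else if x = Some (MNode {#}) then {{[]}} else {})"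
    using sh by (auto simp: subset_singleton_iff) (auto simp: oshape_def)
  then show ?thesis by (simp add: occ_def)
qed

lemma occ_single_leaf: "occ (Some (MNode {#})) T = num_leaves T"
proof -
  have "occ (Some (MNode {#})) T = num_leaves T choose mleaves (MNode {#})"
    using mleaves_eq_1 by (intro occ_eq_choose) auto
  then show ?thesis by simp
qed

text \<open>Each chosen leaf of \<open>T\<close> may be replaced by any leaf of the \<open>U\<close>
  grafted there. In the induction the power splits over the branches, since the leaf numbers of a
  splitting add up to \<open>oleaves x\<close>.\<close>

lemma occ_graft: "occ x T * num_leaves U ^ oleaves x \<le> occ x (graft U T)"
proof (induction T arbitrary: x)
  case (Node ts)
  show ?case
  proof (cases "ts = []")
    case True
    then show ?thesis by (simp add: occ_Leaf occ_single_leaf)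
  next
    case False
    have "occ x (Node ts) * num_leaves U ^ oleaves x
        = (\<Sum>f\<in>splittings x (length ts). (\<Prod>i<length ts. occ (f i) (ts ! i)) * num_leaves U ^ oleaves x)"
      by (simp add: occ_Node False sum_distrib_right)
    also have "\<dots> = (\<Sum>f\<in>splittings x (length ts).
        \<Prod>i<length ts. occ (f i) (ts ! i) * num_leaves U ^ oleaves (f i))"
      by (intro sum.cong refl) (simp add: prod.distrib power_sum flip: sum_oleaves_splittings)
    also have "\<dots> \<le> (\<Sum>f\<in>splittings x (length ts). \<Prod>i<length ts. occ (f i) (graft U (ts ! i)))"
      using Node.IH by (intro sum_mono prod_mono) auto
    also have "\<dots> = occ x (graft U (Node ts))"
      using False by (simp add: occ_Node)
    finally show ?thesis .
  qed
qed

lemma copies_graft: "copies D T * num_leaves U ^ num_leaves D \<le> copies D (graft U T)"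
  using occ_graft[of "Some (canon D)" T U] by (simp add: copies_eq_occ mleaves_canon)

lemma copies_le_choose: "copies D T \<le> num_leaves T choose num_leaves D"
  using occ_le_choose by (simp add: copies_eq_occ mleaves_canon[symmetric])

section \<open>Densities and their bound by the inducibility\<close>

lemma num_leaves_pos: "num_leaves T > 0"
  using mleaves_pos mleaves_canon by metis

lemma copy_density_nonneg: "copy_density D T \<ge> 0"
  by (simp add: copy_density_def)

lemma copy_density_le_1: "copy_density D T \<le> 1"
  using copies_le_choose[of D T] by (simp add: copy_density_def divide_le_eq)

lemma finite_copy_densities: "finite {copy_density D T | T. P T \<and> num_leaves T = n}"
proof (rule finite_subset)
  let ?N = "n choose num_leaves D"
  show "{copy_density D T | T. P T \<and> num_leaves T = n} \<subseteq> (\<lambda>i. real i / real ?N) ` {..?N}"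
    using copies_le_choose[of D] by (auto simp: copy_density_def)
qed simp

text \<open>Follows from \<open>(N choose k) * fact k \<le> N ^ k\<close>. The power in place of the
  binomial coefficient suits grafting, which multiplies leaf numbers.\<close>

lemma copies_mult_fact_le_density:
  "real (copies D T) * fact (num_leaves D) / real (num_leaves T) ^ num_leaves D \<le> copy_density D T"
proof (cases "num_leaves T choose num_leaves D = 0")
  case True
  then have "copies D T = 0" using copies_le_choose[of D T] by linarith
  then show ?thesis by (simp add: copy_density_def)
next
  case False
  let ?C = "num_leaves T choose num_leaves D"
  have "real (?C * fact (num_leaves D)) \<le> real (num_leaves T ^ num_leaves D)"
    using binomial_fact_pow by (simp only: of_nat_le_iff)
  then have "real ?C * fact (num_leaves D) \<le> real (num_leaves T) ^ num_leaves D" by simp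
  then have "real (copies D T) * (real ?C * fact (num_leaves D))
      \<le> real (copies D T) * real (num_leaves T) ^ num_leaves D"
    by (intro mult_left_mono) auto
  then show ?thesis using False num_leaves_pos[of T]
    by (simp add: copy_density_def divide_simps mult_ac)
qed

text \<open>Grafting trees with \<open>m\<close> leaves multiplies the numerator by at least
  \<open>m ^ k\<close> and the denominator by exactly \<open>m ^ k\<close>. So the left side bounds
  densities of arbitrarily large \<open>d\<close>-ary trees from below, hence also the limit
  superior.\<close>

lemma inducibility_ge:
  assumes "d \<ge> 2" "dary d T"
  shows "real (copies D T) * fact (num_leaves D) / real (num_leaves T) ^ num_leaves D
      \<le> inducibility d D" (is "?L \<le> _")
proof -
  define X where "X n = {copy_density D T | T. dary d T \<and> num_leaves T = n}" for n
  define f where "f n = ereal (Max (X n))" for n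
  have fin: "finite (X n)" for n unfolding X_def by (rule finite_copy_densities)
  have often: "\<exists>n\<ge>N. ereal ?L \<le> f n" for N
  proof -
    \<comment> \<open>\<open>m\<close> is positive and large enough for \<open>T'\<close> to have at
      least \<open>N\<close> leaves.\<close>
    define m where "m = Suc N"
    obtain U where U: "dary d U" "num_leaves U = m" using ex_dary_tree[of m d] assms(1) m_def by auto
    define T' where "T' = graft U T"
    have T': "dary d T'" "num_leaves T' = num_leaves T * m"
      using U assms by (auto simp: T'_def dary_graft num_leaves_graft)
    have "?L = real (copies D T * m ^ num_leaves D) * fact (num_leaves D) / real (num_leaves T') ^ num_leaves D"
    proof -
      have "m > 0" by (simp add: m_def)
      then show ?thesis by (simp add: T' power_mult_distrib)
    qed
    also have "\<dots> \<le> real (copies D T') * fact (num_leaves D) / real (num_leaves T') ^ num_leaves D"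
      using copies_graft[of D T U] U(2)
      by (intro divide_right_mono mult_right_mono) (auto simp: T'_def simp del: of_nat_mult of_nat_power)
    also have "\<dots> \<le> copy_density D T'" by (rule copies_mult_fact_le_density)
    also have "\<dots> \<le> Max (X (num_leaves T'))"
      using T' by (intro Max_ge fin) (auto simp: X_def)
    finally have "ereal ?L \<le> f (num_leaves T')" by (simp add: f_def)
    moreover have "N \<le> num_leaves T'" using T' mult_le_mono1[of 1 "num_leaves T" m] num_leaves_pos[of T] by (simp add: m_def)
    ultimately show ?thesis by blast
  qed
  have "ereal ?L \<le> limsup f"
  proof (rule ccontr)
    assume "\<not> ereal ?L \<le> limsup f"
    then have "\<forall>\<^sub>F n in sequentially. f n < ereal ?L" by (intro Limsup_lessD) auto
    then obtain N where "\<And>n. n \<ge> N \<Longrightarrow> f n < ereal ?L" by (auto simp: eventually_sequentially)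
    then show False using often[of N] by (auto simp: not_le[symmetric])
  qed
  \<comment> \<open>The limit superior has to be finite, because \<open>real_of_ereal\<close> sends
    infinity to 0.\<close>
  moreover have "limsup f \<le> 1"
  proof (rule Limsup_bounded)
    have "f n \<le> 1" if "n \<ge> 1" for n
    proof -
      have "X n \<noteq> {}" using ex_dary_tree[OF that assms(1)] by (auto simp: X_def)
      then have "Max (X n) \<le> 1" using fin by (auto simp: X_def intro: copy_density_le_1)
      then show ?thesis by (simp add: f_def)
    qed
    then show "\<forall>\<^sub>F n in sequentially. f n \<le> 1" by (auto simp: eventually_sequentially)
  qed
  ultimately have "?L \<le> real_of_ereal (limsup f)" by (cases "limsup f") auto
  then show ?thesis by (simp add: inducibility_def f_def[abs_def] X_def)
qed

text \<open>The quotient is the product of \<open>1 - i / n\<close> over \<open>i < k\<close>. Each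
  factor is at least \<open>1 - k / n\<close>, and Bernoulli's inequality bounds the
  \<open>k\<close>-th power of that.\<close>

lemma fact_times_choose_lower_bound:
  assumes "k \<le> n" "n > 0"
  shows "real (n choose k) * fact k / real n ^ k \<ge> 1 - real k ^ 2 / real n"
proof -
  have "1 - real k ^ 2 / real n = 1 + real k * (- (real k / real n))" by (simp add: power2_eq_square)
  also have "\<dots> \<le> (1 + - (real k / real n)) ^ k"
    using assms by (intro Bernoulli_inequality) auto
  also have "\<dots> = (\<Prod>i = 0..<k. real n - real k) / real n ^ k"
    using assms by (simp add: power_divide[symmetric] diff_divide_distrib)
  also have "\<dots> \<le> (\<Prod>i = 0..<k. real n - real i) / real n ^ k"
    using assms by (intro divide_right_mono prod_mono) auto
  also have "(\<Prod>i = 0..<k. real n - real i) = real (n choose k) * fact k"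
    by (simp add: binomial_gbinomial gbinomial_prod_rev)
  finally show ?thesis .
qed

lemma copy_density_le_inducibility:
  assumes "d \<ge> 2" "dary d T"
  shows "copy_density D T \<le> inducibility d D + real (num_leaves D) ^ 2 / real (num_leaves T)"
proof -
  define n k where "n = num_leaves T" and "k = num_leaves D"
  define L where "L = real (copies D T) * fact k / real n ^ k"
  have L: "L \<le> inducibility d D" using inducibility_ge[OF assms] by (simp add: L_def n_def k_def)
  have "n > 0" using num_leaves_pos by (simp add: n_def)
  show ?thesis
  proof (cases "k \<le> n")
    case True
    then have "n choose k > 0" by simp
    then have eq: "L = copy_density D T * (real (n choose k) * fact k / real n ^ k)"
      by (simp add: L_def copy_density_def n_def k_def)
    have "copy_density D T * (1 - real k ^ 2 / real n) \<le> L"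
      unfolding eq using fact_times_choose_lower_bound[OF True \<open>n > 0\<close>] copy_density_nonneg
      by (intro mult_left_mono) auto
    \<comment> \<open>The density is at most 1, so the correction costs at most
      \<open>k ^ 2 / n\<close>.\<close>
    moreover have "copy_density D T * (real k ^ 2 / real n) \<le> 1 * (real k ^ 2 / real n)"
      by (intro mult_right_mono copy_density_le_1) auto
    ultimately have "copy_density D T \<le> L + real k ^ 2 / real n" by (simp add: algebra_simps)
    then show ?thesis using L by (simp add: n_def k_def)
  next
    case False
    then have "copy_density D T = 0" by (simp add: copy_density_def n_def k_def)
    moreover have "L \<ge> 0" by (simp add: L_def)
    ultimately show ?thesis using L by (simp add: add_nonneg_nonneg)
  qed
qed

subsection \<open>The balanced trees\<close>

locale balanced =
  fixes d :: nat
  assumes d_ge_2: "d \<ge> 2"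
begin

section \<open>Sizes and weights of the branches\<close>

definition child_index :: "nat \<Rightarrow> nat \<Rightarrow> nat" where
  "child_index n i = (if i < d - (n - 1) mod d then (n - 1) div d else (n - 1) div d + 1)"

definition H_size :: "nat \<Rightarrow> nat" where
  "H_size n = (d - 1) * n + 1"

definition weight :: "nat \<Rightarrow> nat \<Rightarrow> real" where
  "weight n i = real (H_size (child_index n i)) / real (H_size n)"

lemma H_tree_Node:
  assumes "n > 0"
  shows "H_tree d n = Node (map (\<lambda>i. H_tree d (child_index n i)) [0..<d])"
proof -
  let ?s = "(n - 1) div d" and ?b = "(n - 1) mod d"
  have b: "?b < d" using d_ge_2 by simp
  have "H_tree d n = Node (replicate (d - ?b) (H_tree d ?s) @ replicate ?b (H_tree d (?s + 1)))"
    using assms by (subst H_tree.simps) (simp add: Let_def)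
  also have "replicate (d - ?b) (H_tree d ?s) @ replicate ?b (H_tree d (?s + 1))
      = map (\<lambda>i. H_tree d (child_index n i)) [0..<d]"
    using b by (intro nth_equalityI) (auto simp: nth_append child_index_def)
  finally show ?thesis .
qed

lemma sum_child_index:
  assumes "n > 0"
  shows "(\<Sum>i<d. child_index n i) = n - 1"
proof -
  let ?s = "(n - 1) div d" and ?b = "(n - 1) mod d"
  have b: "?b < d" using d_ge_2 by simp
  have "(\<Sum>i<d. child_index n i) = (\<Sum>i<d. ?s + (if i < d - ?b then 0 else 1))"
    by (intro sum.cong) (auto simp: child_index_def)
  also have "\<dots> = d * ?s + (\<Sum>i<d. if i < d - ?b then 0 else 1)" by (simp add: sum.distrib)
  also have "(\<Sum>i<d. if i < d - ?b then 0 else 1) = (\<Sum>i\<in>{d - ?b..<d}. 1 :: nat)"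
    by (intro sum.mono_neutral_cong_right) auto
  also have "d * ?s + (\<Sum>i\<in>{d - ?b..<d}. 1) = n - 1" using b by simp
  finally show ?thesis .
qed

lemma child_index_less: "n > 0 \<Longrightarrow> i < d \<Longrightarrow> child_index n i < n"
  using member_le_sum[of i "{..<d}" "child_index n"] sum_child_index[of n] by simp

lemma sum_H_size_children:
  assumes "n > 0"
  shows "(\<Sum>i<d. H_size (child_index n i)) = H_size n"
proof -
  have "(\<Sum>i<d. H_size (child_index n i)) = (\<Sum>i<d. (d - 1) * child_index n i) + d"
    by (simp add: H_size_def sum.distrib del: One_nat_def)
  also have "\<dots> = (d - 1) * (n - 1) + d"
    by (simp only: sum_distrib_left[symmetric] sum_child_index[OF assms])
  also have "\<dots> = H_size n" using assms d_ge_2 by (cases n) (auto simp: H_size_def)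
  finally show ?thesis .
qed

lemma num_leaves_H_tree: "num_leaves (H_tree d n) = H_size n"
proof (induction n rule: less_induct)
  case (less n)
  show ?case
  proof (cases "n = 0")
    case True
    then show ?thesis by (simp add: H_tree.simps H_size_def)
  next
    case False
    then have "num_leaves (H_tree d n) = (\<Sum>i<d. num_leaves (H_tree d (child_index n i)))"
      using d_ge_2 by (simp add: H_tree_Node num_leaves_Node)
    also have "\<dots> = (\<Sum>i<d. H_size (child_index n i))"
      using False by (intro sum.cong refl less.IH child_index_less) auto
    finally show ?thesis using False by (simp add: sum_H_size_children)
  qed
qed

lemma strictly_dary_H_tree: "strictly_dary d (H_tree d n)"
proof (induction n rule: less_induct)
  case (less n)
  show ?case
  proof (cases "n = 0")
    case True
    then show ?thesis by (simp add: H_tree.simps)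
  next
    case False
    then show ?thesis using less.IH child_index_less by (auto simp: H_tree_Node)
  qed
qed

lemma Suc_le_H_size: "Suc n \<le> H_size n"
  using d_ge_2 by (cases "d - 1") (auto simp: H_size_def)

lemma H_size_pos: "real (H_size n) > 0" "real (H_size n) \<ge> 1"
  using Suc_le_H_size[of n] by linarith+

lemma weight_nonneg: "weight n i \<ge> 0"
  by (simp add: weight_def)

lemma sum_weight: "n > 0 \<Longrightarrow> (\<Sum>i<d. weight n i) = 1"
  using H_size_pos(1)[of n]
  by (simp add: weight_def sum_divide_distrib[symmetric] sum_H_size_children flip: of_nat_sum)

text \<open>Each branch has \<open>H_size n / d\<close> leaves up to a bounded error. The estimates
  include \<open>n = 0\<close>, where \<open>n - 1\<close> truncates to 0, as \<open>approx\<close>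
  speaks of every \<open>n\<close>.\<close>

lemma H_size_less_children:
  "H_size n \<le> d * H_size (child_index n i) + d * d" "d * H_size (child_index n i) \<le> H_size n + d * d"
proof -
  define s b where "s = (n - 1) div d" and "b = (n - 1) mod d"
  obtain e where e: "d = Suc e" using d_ge_2 by (cases d) auto
  have n: "n \<le> d * s + b + 1" "b < d"
    using d_ge_2 div_mult_mod_eq[of "n - 1" d] by (auto simp: s_def b_def mult.commute)
  have "d * s \<le> n - 1" by (simp add: s_def)
  define c where "c = child_index n i"
  have c: "s \<le> c" "c \<le> s + 1" by (auto simp: c_def child_index_def s_def)
  have "n \<le> d * c + d" using n mult_le_mono2[OF c(1), of d] by linarith
  then have "e * n \<le> e * (d * c + d)" by (rule mult_le_mono2)
  then have "(d - 1) * n + 1 \<le> d * ((d - 1) * c + 1) + d * d" by (simp add: e algebra_simps)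
  then show "H_size n \<le> d * H_size (child_index n i) + d * d" by (simp add: H_size_def c_def)
  have "d * c \<le> n + d" using \<open>d * s \<le> n - 1\<close> mult_le_mono2[OF c(2), of d] by simp
  then have "e * (d * c) \<le> e * (n + d)" by (rule mult_le_mono2)
  then have "d * ((d - 1) * c + 1) \<le> (d - 1) * n + 1 + d * d" by (simp add: e algebra_simps)
  then show "d * H_size (child_index n i) \<le> H_size n + d * d" by (simp add: H_size_def c_def)
qed

text \<open>The value is attained for \<open>d = 2\<close> and \<open>n = 2\<close>, where the
  branches have 1 and 2 leaves. A bound below 1 uniform in \<open>n\<close> is what yields the
  contraction in \<open>approx_recursion\<close>.\<close>

lemma weight_le:
  assumes "n > 0" "i < d"
  shows "weight n i \<le> 2 / 3"
proof -
  define s b where "s = (n - 1) div d" and "b = (n - 1) mod d"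
  obtain e where e: "d = Suc (Suc e)" using d_ge_2 by (metis Suc_le_D numeral_2_eq_2 Suc_le_mono)
  have n: "n = d * s + b + 1" using assms d_ge_2 by (simp add: s_def b_def)
  have "3 * H_size (child_index n i) \<le> 2 * H_size n"
  proof (cases "b = 0")
    case True
    then have "child_index n i = s" using assms by (simp add: child_index_def s_def b_def)
    moreover have "3 * ((d - 1) * s + 1) \<le> 2 * ((d - 1) * n + 1)"
      unfolding n True e by (simp add: algebra_simps)
    ultimately show ?thesis by (simp add: H_size_def)
  next
    case False
    then obtain b' where b': "b = Suc b'" by (cases b) auto
    have "child_index n i \<le> s + 1" by (simp add: child_index_def s_def)
    then have "(d - 1) * child_index n i \<le> (d - 1) * (s + 1)" by (rule mult_le_mono2)
    then have "3 * H_size (child_index n i) \<le> 3 * ((d - 1) * (s + 1) + 1)" by (simp add: H_size_def)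
    also have "\<dots> \<le> 2 * ((d - 1) * n + 1)" unfolding n b' e by (simp add: algebra_simps)
    also have "\<dots> = 2 * H_size n" by (simp add: H_size_def)
    finally show ?thesis .
  qed
  then have "3 * real (H_size (child_index n i)) \<le> 2 * real (H_size n)" by linarith
  then show ?thesis using H_size_pos(1)[of n] by (simp add: weight_def divide_simps)
qed

section \<open>Convergence with an error of order 1 / H_size\<close>

definition approx :: "(nat \<Rightarrow> real) \<Rightarrow> real \<Rightarrow> bool" where
  "approx u a \<longleftrightarrow> (\<exists>C. \<forall>n. \<bar>u n - a\<bar> \<le> C / real (H_size n))"

lemma approxI: "(\<And>n. \<bar>u n - a\<bar> \<le> C / real (H_size n)) \<Longrightarrow> approx u a"
  by (auto simp: approx_def)

lemma approxD:
  assumes "approx u a"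
  shows "\<exists>C\<ge>0. \<forall>n. \<bar>u n - a\<bar> \<le> C / real (H_size n)"
proof -
  obtain C where C: "\<And>n. \<bar>u n - a\<bar> \<le> C / real (H_size n)" using assms by (auto simp: approx_def)
  have "C \<ge> 0" using C[of 0] by (simp add: H_size_def)
  then show ?thesis using C by blast
qed

lemma approx_const [intro]: "approx (\<lambda>_. a) a"
  by (rule approxI[of _ _ 0]) simp

lemma approx_add:
  assumes "approx u a" "approx v b"
  shows "approx (\<lambda>n. u n + v n) (a + b)"
proof -
  obtain C where C: "C \<ge> 0" "\<And>n. \<bar>u n - a\<bar> \<le> C / real (H_size n)" using approxD[OF assms(1)] by blast
  obtain C' where C': "C' \<ge> 0" "\<And>n. \<bar>v n - b\<bar> \<le> C' / real (H_size n)" using approxD[OF assms(2)] by blast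
  have "\<bar>u n + v n - (a + b)\<bar> \<le> (C + C') / real (H_size n)" for n
    using C(2)[of n] C'(2)[of n] by (simp add: add_divide_distrib)
  then show ?thesis by (rule approxI)
qed

lemma approx_mult:
  assumes "approx u a" "approx v b"
  shows "approx (\<lambda>n. u n * v n) (a * b)"
proof -
  obtain C where C: "C \<ge> 0" "\<And>n. \<bar>u n - a\<bar> \<le> C / real (H_size n)" using approxD[OF assms(1)] by blast
  obtain C' where C': "C' \<ge> 0" "\<And>n. \<bar>v n - b\<bar> \<le> C' / real (H_size n)" using approxD[OF assms(2)] by blast
  have "\<bar>u n * v n - a * b\<bar> \<le> (C * (\<bar>b\<bar> + C') + \<bar>a\<bar> * C') / real (H_size n)" for n
  proof -
    have "C' / real (H_size n) \<le> C'" using C'(1) H_size_pos[of n] by (simp add: divide_le_eq mult_le_cancel_left1)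
    then have v: "\<bar>v n\<bar> \<le> \<bar>b\<bar> + C'" using C'(2)[of n] by linarith
    have "\<bar>u n * v n - a * b\<bar> = \<bar>(u n - a) * v n + a * (v n - b)\<bar>" by (simp add: algebra_simps)
    also have "\<dots> \<le> \<bar>u n - a\<bar> * \<bar>v n\<bar> + \<bar>a\<bar> * \<bar>v n - b\<bar>"
      by (metis abs_triangle_ineq abs_mult)
    also have "\<dots> \<le> (C / real (H_size n)) * (\<bar>b\<bar> + C') + \<bar>a\<bar> * (C' / real (H_size n))"
      using C C' v by (intro add_mono mult_mono) auto
    finally show ?thesis by (simp add: add_divide_distrib)
  qed
  then show ?thesis by (rule approxI)
qed

lemma approx_sum: "(\<And>i. i \<in> A \<Longrightarrow> approx (u i) (a i)) \<Longrightarrow> approx (\<lambda>n. \<Sum>i\<in>A. u i n) (\<Sum>i\<in>A. a i)"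
  by (induction A rule: infinite_finite_induct) (auto intro: approx_add)

lemma approx_prod: "(\<And>i. i \<in> A \<Longrightarrow> approx (u i) (a i)) \<Longrightarrow> approx (\<lambda>n. \<Prod>i\<in>A. u i n) (\<Prod>i\<in>A. a i)"
  by (induction A rule: infinite_finite_induct) (auto intro: approx_mult)

lemma approx_power: "approx u a \<Longrightarrow> approx (\<lambda>n. u n ^ k) (a ^ k)"
  by (induction k) (auto intro: approx_mult)

lemma approx_child:
  assumes "approx u a"
  shows "approx (\<lambda>n. u (child_index n i)) a"
proof -
  obtain C where C: "C \<ge> 0" "\<And>n. \<bar>u n - a\<bar> \<le> C / real (H_size n)" using approxD[OF assms] by blast
  have "\<bar>u (child_index n i) - a\<bar> \<le> C * (d + d * d) / real (H_size n)" for n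
  proof -
    \<comment> \<open>The branch has at least one leaf, so the additive error \<open>d * d\<close>
      is absorbed into the factor \<open>d + d * d\<close>.\<close>
    have "d * d \<le> d * d * H_size (child_index n i)" by (simp add: H_size_def)
    then have "H_size n \<le> (d + d * d) * H_size (child_index n i)"
      using H_size_less_children(1)[of n i] by (simp only: add_mult_distrib)
    then have "real (H_size n) \<le> real ((d + d * d) * H_size (child_index n i))" by (simp only: of_nat_le_iff)
    then have "C * real (H_size n) \<le> C * ((d + d * d) * real (H_size (child_index n i)))"
      using C(1) by (intro mult_left_mono) auto
    then have "C / real (H_size (child_index n i)) \<le> C * (d + d * d) / real (H_size n)"
      using H_size_pos(1) by (simp add: divide_simps mult_ac)
    then show ?thesis using C(2)[of "child_index n i"] by linarith
  qed
  then show ?thesis by (rule approxI)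
qed

lemma approx_weight: "approx (\<lambda>n. weight n i) (1 / real d)"
proof (rule approxI)
  fix n
  have "\<bar>real d * real (H_size (child_index n i)) - real (H_size n)\<bar> \<le> real d * real d"
  proof -
    have "real (H_size n) \<le> real (d * H_size (child_index n i) + d * d)"
      "real (d * H_size (child_index n i)) \<le> real (H_size n + d * d)"
      using H_size_less_children[of n i] by (simp_all only: of_nat_le_iff)
    then show ?thesis by (simp add: abs_le_iff)
  qed
  then have "\<bar>real d * real (H_size (child_index n i)) - real (H_size n)\<bar> / (real d * real (H_size n))
      \<le> real d * real d / (real d * real (H_size n))"
    using H_size_pos(1)[of n] by (intro divide_right_mono) auto
  moreover have "weight n i - 1 / real d
      = (real d * real (H_size (child_index n i)) - real (H_size n)) / (real d * real (H_size n))"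
    using H_size_pos(1)[of n] d_ge_2 by (simp add: weight_def field_simps)
  ultimately show "\<bar>weight n i - 1 / real d\<bar> \<le> real d / real (H_size n)"
    using H_size_pos(1)[of n] d_ge_2 by (simp add: abs_divide abs_mult)
qed

lemma approx_LIMSEQ:
  assumes "approx u a"
  shows "u \<longlonglongrightarrow> a"
proof -
  obtain C where C: "C \<ge> 0" "\<And>n. \<bar>u n - a\<bar> \<le> C / real (H_size n)" using approxD[OF assms] by blast
  have "\<bar>u n - a\<bar> \<le> C / real (Suc n)" for n
  proof -
    have "C / real (H_size n) \<le> C / real (Suc n)"
      using C(1) Suc_le_H_size[of n] H_size_pos(1)[of n] by (intro divide_left_mono) auto
    then show ?thesis using C(2)[of n] by linarith
  qed
  then have upper: "\<forall>\<^sub>F n in sequentially. \<bar>u n - a\<bar> \<le> C / real (Suc n)" by (rule always_eventually[OF allI])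
  have lim: "(\<lambda>n. C / real (Suc n)) \<longlonglongrightarrow> 0"
    using LIMSEQ_Suc[OF lim_const_over_n[of C]] .
  have "\<forall>\<^sub>F n in sequentially. 0 \<le> \<bar>u n - a\<bar>" by simp
  then have "(\<lambda>n. \<bar>u n - a\<bar>) \<longlonglongrightarrow> 0"
    by (rule tendsto_sandwich[OF _ upper tendsto_const lim])
  then show ?thesis by (rule LIM_zero_cancel[OF tendsto_rabs_zero_cancel])
qed

text \<open>For \<^term>\<open>k \<ge> 3\<close> the linear part of the recursion contracts the error bound \<open>M / H_size n\<close>:
  \<open>(\<Sum>i<d. M / H_size (child_index n i) * weight n i ^ k)\<close> is \<open>M / H_size n\<close> times
  \<open>(\<Sum>i<d. weight n i ^ (k - 1)) \<le> 2/3\<close>.\<close>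

lemma approx_recursion:
  assumes k: "k \<ge> 3" and \<rho>: "approx \<rho> \<alpha>"
    and rec: "\<And>n. n > 0 \<Longrightarrow> y n = (\<Sum>i<d. y (child_index n i) * weight n i ^ k) + \<rho> n"
  shows "\<exists>a. approx y a"
proof -
  \<comment> \<open>The limit of \<open>\<Sum>i<d. weight n i ^ k\<close>, as all weights tend to
    \<open>1 / d\<close>.\<close>
  define \<beta> where "\<beta> = real d * (1 / real d) ^ k"
  obtain l where l: "k = Suc (Suc l)" "l > 0" using k by (metis Suc_le_D numeral_3_eq_3 Suc_le_mono zero_less_Suc)
  have "\<beta> = (1 / real d) ^ Suc l" using d_ge_2 l by (simp add: \<beta>_def)
  also have "\<dots> < 1" using d_ge_2 by (intro power_Suc_less_one) auto
  finally have "\<beta> < 1" .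
  \<comment> \<open>The only candidate for the limit: the solution of
    \<open>a = a * \<beta> + \<alpha>\<close>.\<close>
  define a where "a = \<alpha> / (1 - \<beta>)"
  have a: "a * \<beta> + \<alpha> - a = 0" using \<open>\<beta> < 1\<close> by (simp add: a_def field_simps)
  \<comment> \<open>The defect left when the constant \<open>a\<close> is put into the recursion; by
    the choice of \<open>a\<close> it has order \<open>1 / H_size n\<close>.\<close>
  define \<epsilon> where "\<epsilon> n = a * (\<Sum>i<d. weight n i ^ k) + \<rho> n + (- a)" for n
  have "approx \<epsilon> (a * (\<Sum>i<d. (1 / real d) ^ k) + \<alpha> + (- a))"
    unfolding \<epsilon>_def
    by (intro approx_add approx_mult approx_sum approx_power approx_weight approx_const \<rho>)
  then have "approx \<epsilon> 0" using a by (simp add: \<beta>_def)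
  then obtain C where C: "C \<ge> 0" "\<And>n. \<bar>\<epsilon> n\<bar> \<le> C / real (H_size n)" using approxD by fastforce
  \<comment> \<open>The first entry settles \<open>n = 0\<close>, where \<open>H_size 0 = 1\<close>.
    The second gives \<open>M * (2 / 3) + C \<le> M\<close> in the induction step.\<close>
  define M where "M = max \<bar>y 0 - a\<bar> (3 * C)"
  have M: "M \<ge> 0" "\<bar>y 0 - a\<bar> \<le> M" "3 * C \<le> M" using C by (auto simp: M_def)
  have "\<bar>y n - a\<bar> \<le> M / real (H_size n)" for n
  proof (induction n rule: less_induct)
    case (less n)
    show ?case
    proof (cases "n = 0")
      case True
      then show ?thesis using M by (simp add: H_size_def)
    next
      case False
      then have n: "n > 0" by simp
      have bound: "\<bar>(y (child_index n i) - a) * weight n i ^ k\<bar> \<le> M / real (H_size n) * (2 / 3 * weight n i)"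
        if i: "i < d" for i
      proof -
        let ?w = "weight n i"
        have w: "0 \<le> ?w" "?w \<le> 2 / 3" using weight_nonneg weight_le[OF n i] by auto
        have "\<bar>(y (child_index n i) - a) * ?w ^ k\<bar> \<le> M / real (H_size (child_index n i)) * ?w ^ k"
          using mult_right_mono[OF less.IH[OF child_index_less[OF n i]], of "?w ^ k"] w by (simp add: abs_mult)
        also have "\<dots> = M / real (H_size n) * ?w ^ Suc l"
          using H_size_pos(1)[of n] H_size_pos(1)[of "child_index n i"] by (simp add: l weight_def)
        also have "?w ^ Suc l \<le> 2 / 3 * ?w"
        proof -
          obtain l' where "l = Suc l'" using l(2) by (cases l) auto
          moreover have "?w ^ l' \<le> 1" using w by (intro power_le_one) auto
          then have "?w * ?w ^ l' \<le> 2 / 3 * 1" using w by (intro mult_mono) auto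
          then have "?w * (?w * ?w ^ l') \<le> ?w * (2 / 3 * 1)" using w by (intro mult_left_mono) auto
          ultimately show ?thesis by simp
        qed
        then have "M / real (H_size n) * ?w ^ Suc l \<le> M / real (H_size n) * (2 / 3 * ?w)"
          using M(1) by (intro mult_left_mono) auto
        finally show ?thesis .
      qed
      have "y n - a = (\<Sum>i<d. (y (child_index n i) - a) * weight n i ^ k) + \<epsilon> n"
        by (simp add: rec[OF n] \<epsilon>_def sum_distrib_left sum_subtractf left_diff_distrib)
      then have "\<bar>y n - a\<bar> \<le> (\<Sum>i<d. \<bar>(y (child_index n i) - a) * weight n i ^ k\<bar>) + \<bar>\<epsilon> n\<bar>"
        using sum_abs[of "\<lambda>i. (y (child_index n i) - a) * weight n i ^ k" "{..<d}"] by linarith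
      also have "\<dots> \<le> (\<Sum>i<d. M / real (H_size n) * (2 / 3 * weight n i)) + C / real (H_size n)"
        using bound C(2) by (intro add_mono sum_mono) auto
      also have "(\<Sum>i<d. M / real (H_size n) * (2 / 3 * weight n i)) = M / real (H_size n) * (2 / 3)"
        by (simp only: sum_distrib_left[symmetric] sum_weight[OF n])
      also have "M / real (H_size n) * (2 / 3) + C / real (H_size n) = (M * (2 / 3) + C) / real (H_size n)"
        by (simp add: add_divide_distrib)
      also have "\<dots> \<le> M / real (H_size n)"
        using M by (intro divide_right_mono) auto
      finally show ?thesis .
    qed
  qed
  then show ?thesis by (auto intro: approxI)
qed

section \<open>Scaled counts in the balanced trees\<close>

definition scaled_occ :: "mtree option \<Rightarrow> nat \<Rightarrow> real" where
  "scaled_occ x n = real (occ x (H_tree d n)) / real (H_size n) ^ oleaves x"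

lemma single_splitting:
  assumes "f \<in> splittings (Some M) n" "f j = Some M" "j < n"
  shows "f = (\<lambda>i\<in>{..<n}. if i = j then Some M else None)"
proof -
  have "(\<Sum>i<n. oleaves (f i)) = mleaves M" using sum_oleaves_splittings[OF assms(1)] by simp
  moreover have "(\<Sum>i<n. oleaves (f i)) = mleaves M + (\<Sum>i\<in>{..<n} - {j}. oleaves (f i))"
    using assms by (subst sum.remove[of _ j]) auto
  ultimately have "oleaves (f i) = 0" if "i < n" "i \<noteq> j" for i using that by simp
  then have "f i = None" if "i < n" "i \<noteq> j" for i
    using that mleaves_pos by (cases "f i") (metis oleaves_simps(2) less_irrefl)+
  moreover have "f \<in> extensional {..<n}" using assms by (simp add: splittings_def)
  ultimately show ?thesis using assms by (auto simp: fun_eq_iff extensional_def)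
qed

lemma single_splitting_mem:
  assumes "j < n"
  shows "(\<lambda>i\<in>{..<n}. if i = j then Some M else None) \<in> splittings (Some M) n" (is "?f \<in> _")
proof -
  have "filter_mset (\<lambda>i. ?f i \<noteq> None) (mset_set {..<n}) = filter_mset (\<lambda>i. i = j) (mset_set {..<n})"
    by (intro filter_mset_cong) auto
  also have "\<dots> = {#j#}" using assms by (simp add: filter_eq_replicate_mset)
  finally have "somes ?f n = {#M#}" using assms unfolding somes_def by simp
  then show ?thesis by (simp add: splittings_def omerge_def)
qed

text \<open>When no single branch contains the whole shape, \<open>merge\<close> cannot have
  collapsed a singleton, so it has built the root of \<open>MNode B\<close>.\<close>

lemma proper_splitting:
  assumes "f \<in> splittings (Some (MNode B)) n" "\<And>i. i < n \<Longrightarrow> f i \<noteq> Some (MNode B)"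
  shows "somes f n = B"
proof -
  have m: "merge (somes f n) = MNode B" using assms(1) by (auto simp: splittings_def omerge_def split: if_splits)
  have "size (somes f n) \<noteq> 1"
  proof
    assume "size (somes f n) = 1"
    then obtain M where M: "somes f n = {#M#}" using size_1_singleton_mset by blast
    then have "MNode B \<in># somes f n" using m by simp
    then obtain i where "i < n" "f i = Some (MNode B)" by (auto simp: somes_def)
    then show False using assms(2) by blast
  qed
  then show ?thesis using m by (simp add: merge_not_single)
qed

text \<open>Scaling by a power rather than a binomial coefficient makes the recursion exact: the
  exponents of a splitting add up to \<open>oleaves x\<close>, so the power of
  \<open>H_size n\<close> distributes over the product and leaves the weights behind.\<close>

lemma scaled_occ_Node:
  assumes "n > 0"
  shows "scaled_occ x n = (\<Sum>f\<in>splittings x d. \<Prod>i<d.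
      scaled_occ (f i) (child_index n i) * weight n i ^ oleaves (f i))"
proof -
  have "occ x (H_tree d n) = (\<Sum>f\<in>splittings x d. \<Prod>i<d. occ (f i) (H_tree d (child_index n i)))"
    using d_ge_2 by (simp add: H_tree_Node[OF assms] occ_Node)
  then have "scaled_occ x n = (\<Sum>f\<in>splittings x d.
      (\<Prod>i<d. real (occ (f i) (H_tree d (child_index n i)))) / real (H_size n) ^ oleaves x)"
    by (simp add: scaled_occ_def sum_divide_distrib)
  also have "\<dots> = (\<Sum>f\<in>splittings x d. \<Prod>i<d.
      scaled_occ (f i) (child_index n i) * weight n i ^ oleaves (f i))"
  proof (rule sum.cong[OF refl])
    fix f assume "f \<in> splittings x d"
    then have "real (H_size n) ^ oleaves x = (\<Prod>i<d. real (H_size n) ^ oleaves (f i))"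
      by (simp add: sum_oleaves_splittings flip: power_sum)
    then have "(\<Prod>i<d. real (occ (f i) (H_tree d (child_index n i)))) / real (H_size n) ^ oleaves x
      = (\<Prod>i<d. real (occ (f i) (H_tree d (child_index n i))) / real (H_size n) ^ oleaves (f i))"
      by (simp add: prod_dividef)
    also have "\<dots> = (\<Prod>i<d. scaled_occ (f i) (child_index n i) * weight n i ^ oleaves (f i))"
      using H_size_pos(1) by (intro prod.cong refl)
        (simp add: scaled_occ_def weight_def power_divide order_less_imp_not_eq2)
    finally show "(\<Prod>i<d. real (occ (f i) (H_tree d (child_index n i)))) / real (H_size n) ^ oleaves x
      = (\<Prod>i<d. scaled_occ (f i) (child_index n i) * weight n i ^ oleaves (f i))" .
  qed
  finally show ?thesis .
qed

lemma scaled_occ_None [simp]: "scaled_occ None n = 1"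
  by (simp add: scaled_occ_def)

text \<open>Splittings with all of \<open>M\<close> in one branch give the linear part of a
  recursion. The others involve only members of \<open>B\<close>, whose scaled counts converge by
  the induction hypothesis.\<close>

lemma approx_scaled_occ: "no_unary M \<Longrightarrow> \<exists>a. approx (scaled_occ (Some M)) a"
proof (induction M)
  case (MNode B)
  define M where "M = MNode B"
  have nu: "no_unary M" using MNode.prems by (simp add: M_def)
  \<comment> \<open>One and two leaves are treated by explicit formulas: for exponents
    \<open>k \<le> 2\<close> the sum of \<open>weight n i ^ (k - 1)\<close> is at least 1, so
    nothing contracts.\<close>
  consider "mleaves M = 1" | "mleaves M = 2" | "mleaves M \<ge> 3"
    using mleaves_pos[of M] by linarith
  then have "\<exists>a. approx (scaled_occ (Some M)) a"
  proof cases
    case 1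
    then have "M = MNode {#}" using mleaves_eq_1[OF nu] by simp
    then have "scaled_occ (Some M) n = 1" for n
      using H_size_pos(1)[of n] by (simp add: scaled_occ_def occ_single_leaf num_leaves_H_tree)
    then have "scaled_occ (Some M) = (\<lambda>_. 1)" by auto
    then show ?thesis by auto
  next
    case 2
    have "\<bar>scaled_occ (Some M) n - 1 / 2\<bar> \<le> (1 / 2) / real (H_size n)" for n
    proof -
      have "occ (Some M) (H_tree d n) = num_leaves (H_tree d n) choose mleaves M"
        using nu 2 mleaves_eq_2 by (intro occ_eq_choose) metis+
      then have "occ (Some M) (H_tree d n) = H_size n choose 2" using 2 by (simp add: num_leaves_H_tree)
      moreover have "real (H_size n choose 2) = real (H_size n) * (real (H_size n) - 1) / 2"
        by (cases "H_size n") (auto simp: choose_two real_of_nat_div algebra_simps)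
      ultimately have eq: "scaled_occ (Some M) n = real (H_size n) * (real (H_size n) - 1) / 2 / real (H_size n) ^ 2"
        by (simp only: scaled_occ_def oleaves_simps 2)
      have "scaled_occ (Some M) n - 1 / 2 = - ((1 / 2) / real (H_size n))"
        unfolding eq using H_size_pos(1)[of n] by (simp add: field_simps power2_eq_square)
      then show ?thesis using H_size_pos(1)[of n] by simp
    qed
    then have "approx (scaled_occ (Some M)) (1 / 2)" by (rule approxI)
    then show ?thesis by blast
  next
    case 3
    let ?S = "splittings (Some M) d"
    let ?single = "\<lambda>j. \<lambda>i\<in>{..<d}. if i = j then Some M else None"
    \<comment> \<open>The splittings that distribute the branches of \<open>M\<close> over distinct
      branches of the tree; they form the inhomogeneous term of the recursion.\<close>
    define P where "P = {f \<in> ?S. \<forall>i<d. f i \<noteq> Some M}"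
    define t where "t f n = (\<Prod>i<d. scaled_occ (f i) (child_index n i) * weight n i ^ oleaves (f i))" for f n
    have "\<exists>a. approx (scaled_occ (f i)) a" if f: "f \<in> P" and i: "i < d" for f i
    proof (cases "f i")
      case None
      then have "scaled_occ (f i) = (\<lambda>_. 1)" by (auto simp: fun_eq_iff)
      then show ?thesis by auto
    next
      case (Some M')
      have "M' \<in># somes f d" using Some i by (rule somes_memI)
      also have "somes f d = B" using f proper_splitting by (auto simp: P_def M_def)
      finally show ?thesis using MNode Some by auto
    qed
    then obtain A where A: "\<And>f i. f \<in> P \<Longrightarrow> i < d \<Longrightarrow> approx (scaled_occ (f i)) (A f i)" by metis
    have \<rho>: "approx (\<lambda>n. \<Sum>f\<in>P. t f n) (\<Sum>f\<in>P. \<Prod>i<d. A f i * (1 / real d) ^ oleaves (f i))"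
      unfolding t_def using A
      by (intro approx_sum approx_prod approx_mult approx_power approx_child approx_weight) auto
    have "inj_on ?single {..<d}"
    proof (rule inj_onI)
      fix j j' assume j: "j \<in> {..<d}" "j' \<in> {..<d}" and eq: "?single j = ?single j'"
      show "j = j'" using fun_cong[OF eq, of j] j by (auto split: if_splits)
    qed
    have part: "?S = ?single ` {..<d} \<union> P"
      using single_splitting single_splitting_mem by (auto simp: P_def) blast
    have disj: "?single ` {..<d} \<inter> P = {}" by (auto simp: P_def)
    have finP: "finite P" unfolding P_def by (simp add: finite_splittings)
    have "scaled_occ (Some M) n
        = (\<Sum>j<d. scaled_occ (Some M) (child_index n j) * weight n j ^ mleaves M) + (\<Sum>f\<in>P. t f n)"
      if n: "n > 0" for n
    proof -
      have "scaled_occ (Some M) n = (\<Sum>f\<in>?S. t f n)"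
        using scaled_occ_Node[OF n] by (simp add: t_def)
      also have "\<dots> = (\<Sum>f\<in>?single ` {..<d}. t f n) + (\<Sum>f\<in>P. t f n)"
        unfolding part using disj finP by (intro sum.union_disjoint) auto
      also have "(\<Sum>f\<in>?single ` {..<d}. t f n) = (\<Sum>j<d. t (?single j) n)"
        using \<open>inj_on ?single {..<d}\<close> by (simp add: sum.reindex)
      also have "\<dots> = (\<Sum>j<d. scaled_occ (Some M) (child_index n j) * weight n j ^ mleaves M)"
      proof (rule sum.cong[OF refl])
        fix j assume "j \<in> {..<d}"
        then have "t (?single j) n = (\<Prod>i<d. if i = j
            then scaled_occ (Some M) (child_index n j) * weight n j ^ mleaves M else 1)"
          unfolding t_def by (intro prod.cong) auto
        then show "t (?single j) n = scaled_occ (Some M) (child_index n j) * weight n j ^ mleaves M"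
          using \<open>j \<in> {..<d}\<close> by (simp add: prod.delta)
      qed
      finally show ?thesis .
    qed
    then show ?thesis by (rule approx_recursion[OF 3 \<rho>])
  qed
  then show ?case by (simp add: M_def)
qed

text \<open>The density times \<open>q = (N choose k) * fact k / N ^ k\<close> is the scaled count
  times \<open>fact k\<close>. As \<open>q\<close> is 1 up to order \<open>1 / N\<close> and
  densities are bounded, the rate carries over.\<close>

lemma approx_copy_density:
  assumes "dary d D"
  shows "\<exists>a. approx (\<lambda>n. copy_density D (H_tree d n)) a"
proof -
  define k where "k = num_leaves D"
  obtain a where "approx (scaled_occ (Some (canon D))) a"
    using approx_scaled_occ no_unary_canon[OF assms] by blast
  then obtain C where C: "C \<ge> 0" "\<And>n. \<bar>scaled_occ (Some (canon D)) n - a\<bar> \<le> C / real (H_size n)"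
    using approxD by blast
  have "\<bar>copy_density D (H_tree d n) - a * fact k\<bar> \<le> (C * fact k + real k ^ 2) / real (H_size n)" for n
  proof -
    define N where "N = H_size n"
    define g where "g = copy_density D (H_tree d n)"
    define q where "q = real (N choose k) * fact k / real N ^ k"
    have N: "N > 0" by (simp add: N_def H_size_def)
    have y: "scaled_occ (Some (canon D)) n * fact k = g * q"
    proof (cases "N choose k = 0")
      case True
      have "copies D (H_tree d n) \<le> N choose k"
        using copies_le_choose[of D "H_tree d n"] by (simp add: num_leaves_H_tree N_def k_def)
      then have "copies D (H_tree d n) = 0" using True by linarith
      then show ?thesis by (simp add: scaled_occ_def g_def copy_density_def flip: copies_eq_occ)
    next
      case False
      then show ?thesis
        by (simp add: scaled_occ_def g_def q_def copy_density_def num_leaves_H_tree mleaves_canon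
            copies_eq_occ N_def k_def)
    qed
    have "\<bar>scaled_occ (Some (canon D)) n * fact k - a * fact k\<bar> \<le> C / real N * fact k"
      using mult_right_mono[OF C(2)[of n], of "fact k"]
      by (simp add: N_def abs_mult flip: left_diff_distrib)
    then have 1: "\<bar>g * q - a * fact k\<bar> \<le> C * fact k / real N" by (simp add: y)
    \<comment> \<open>The difference is \<open>g * (1 - q)\<close> with \<open>g\<close> between 0
      and 1 and \<open>q \<le> 1\<close>; for \<open>k > N\<close> the density itself is 0.\<close>
    have 2: "\<bar>g - g * q\<bar> \<le> real k ^ 2 / real N"
    proof (cases "k \<le> N")
      case True
      have q: "1 - q \<le> real k ^ 2 / real N"
        using fact_times_choose_lower_bound[OF True N] by (simp add: q_def)
      have "real ((N choose k) * fact k) \<le> real (N ^ k)"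
        using binomial_fact_pow by (simp only: of_nat_le_iff)
      then have "q \<le> 1" using N by (simp add: q_def divide_simps)
      have "g * (1 - q) \<le> 1 * (1 - q)"
        using \<open>q \<le> 1\<close> copy_density_le_1 by (intro mult_right_mono) (auto simp: g_def)
      moreover have "0 \<le> g * (1 - q)"
        using \<open>q \<le> 1\<close> copy_density_nonneg by (simp add: g_def)
      ultimately show ?thesis using q by (simp add: right_diff_distrib)
    next
      case False
      then have "g = 0" by (simp add: g_def copy_density_def num_leaves_H_tree N_def k_def)
      then show ?thesis by simp
    qed
    have "\<bar>g - a * fact k\<bar> \<le> \<bar>g * q - a * fact k\<bar> + \<bar>g - g * q\<bar>" by linarith
    then show ?thesis using 1 2 by (simp add: g_def N_def add_divide_distrib)
  qed
  then show ?thesis by (auto intro: approxI)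
qed

end

section \<open>Combining the two bounds\<close>

lemma strictly_dary_imp_dary: "d \<ge> 2 \<Longrightarrow> strictly_dary d T \<Longrightarrow> dary d T"
  by (induction T) auto

theorem theorem10:
  fixes d :: nat and D :: tree
  assumes "d \<ge> 2"
    and "dary d D"
    and "inducibility d D = eta d D"
  shows "(\<lambda>n. Max {copy_density D T | T. strictly_dary d T \<and> num_leaves T = (d - 1) * n + 1}
              - inducibility d D) \<in> O(\<lambda>n. 1 / real n)"
proof -
  interpret balanced d by unfold_locales (rule assms(1))
  define X where "X n = {copy_density D T | T. strictly_dary d T \<and> num_leaves T = (d - 1) * n + 1}" for n
  obtain a where a: "approx (\<lambda>n. copy_density D (H_tree d n)) a"
    using approx_copy_density[OF assms(2)] by blast
  \<comment> \<open>The densities converge, so \<open>lim\<close> in \<open>eta\<close> has the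
    value \<open>a\<close>, and the hypothesis transfers this value to the inducibility.\<close>
  have I: "inducibility d D = a"
    using approx_LIMSEQ[OF a] assms(3) by (simp add: eta_def limI)
  obtain C where C: "C \<ge> 0" "\<And>n. \<bar>copy_density D (H_tree d n) - a\<bar> \<le> C / real (H_size n)"
    using approxD[OF a] by blast
  define K where "K = C + real (num_leaves D) ^ 2"
  have K: "K \<ge> 0" using C by (simp add: K_def)
  have "\<bar>Max (X n) - inducibility d D\<bar> \<le> K * \<bar>1 / real n\<bar>" if n: "n \<ge> 1" for n
  proof -
    have fin: "finite (X n)" unfolding X_def by (rule finite_copy_densities)
    have mem: "copy_density D (H_tree d n) \<in> X n"
      using strictly_dary_H_tree num_leaves_H_tree by (auto simp: X_def H_size_def)
    then have "copy_density D (H_tree d n) \<le> Max (X n)" using fin by simp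
    then have lower: "Max (X n) - inducibility d D \<ge> - (C / real (H_size n))"
      using C(2)[of n] I by linarith
    have "Max (X n) \<in> X n" using fin mem by (intro Max_in) auto
    then obtain T where T: "strictly_dary d T" "num_leaves T = H_size n" "Max (X n) = copy_density D T"
      by (auto simp: X_def H_size_def)
    \<comment> \<open>A strictly \<open>d\<close>-ary tree attaining the maximum is
      \<open>d\<close>-ary, so the density bound for all \<open>d\<close>-ary trees applies to
      it.\<close>
    then have upper: "Max (X n) - inducibility d D \<le> real (num_leaves D) ^ 2 / real (H_size n)"
      using copy_density_le_inducibility[OF assms(1) strictly_dary_imp_dary[OF assms(1) T(1)], of D] by simp
    have pos: "C / real (H_size n) \<ge> 0" "real (num_leaves D) ^ 2 / real (H_size n) \<ge> 0" using C by auto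
    have "\<bar>Max (X n) - inducibility d D\<bar> \<le> K / real (H_size n)"
      unfolding K_def add_divide_distrib using lower upper pos by linarith
    also have "\<dots> \<le> K / real n"
    proof -
      have "n \<le> H_size n" using Suc_le_H_size[of n] by simp
      then show ?thesis using K n by (intro divide_left_mono) auto
    qed
    finally show ?thesis by simp
  qed
  then have "(\<lambda>n. Max (X n) - inducibility d D) \<in> O(\<lambda>n. 1 / real n)"
    by (intro bigoI[where c = K]) (auto simp: eventually_sequentially)
  then show ?thesis by (simp add: X_def)
qed

end
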